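(* Let $k>1$ and $n_1,\dots,n_k\in\{2,3,4,\dots\}$ with $n_1-1\mid n_j-1$ for all $j\in\{1,\dots,k\}$. The logarithmic order of the lower bound $|x|_X\ge\log_B L(x)$ (valid for all $x\in F(n_1,\dots,n_k)$ with a fixed $B\in\mathbb{N}$) is sharp: there exist a constant $C>0$ and a sequence $(x_m)_{m\ge1}$ of elements of $F(n_1,\dots,n_k)$ with $L(x_m)\to\infty$ and $|x_m|_X\le C\log L(x_m)$ for all $m$.
   Context: $F(n_1,\dots,n_k)$ is the group (product $xy=x\circ y$) of piecewise-linear orientation-preserving homeomorphisms of $[0,1]$ with finitely many breakpoints, all in $\mathbb{Z}[\frac{1}{n_1\cdots n_k}]$, and slopes in the multiplicative group $\langle n_1,\dots,n_k\rangle$. An $n$-ary caret (caret of type $n$) has one parent vertex joined by $n$ edges to $n$ child vertices, ordered from left to right. An $(n_1,\dots,n_k)$-ary tree is a rooted tree formed from finitely many (possibly zero) carets of types in $\{n_1,\dots,n_k\}$ by identifying child vertices of carets with parent vertices of other carets. Leaves are numbered $0,1,2,\dots$ from left to right. The root represents $[0,1]$, and the children of an $n$-ary caret represent, from left to right, the $n$ equal consecutive closed subintervals of the parent's interval. A tree-pair diagram $(T_-,T_+)$ is an ordered pair of such trees with equally many leaves (domain tree $T_-$, range tree $T_+$); it represents the element mapping the $i$th leaf interval of $T_-$ affinely and increasingly onto the $i$th leaf interval of $T_+$, for all $i$. Every element is represented by some diagram. A diagram is minimal if it has the fewest leaves among all diagrams representing the same element; $L(x)$ is the number of leaves in either tree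 of a minimal diagram for $x$. Generators. A right $n_1$-string is a tree all of whose carets are of type $n_1$ and have an edge on the rightmost root-to-leaf path. For $j\in\{2,\dots,k\}$, $i\ge0$, $(y_j)_i$ has range tree a right $n_1$-string of $i$ carets with an $n_j$-ary caret attached to its last leaf, and domain tree the right $n_1$-string with the same number of leaves. For $j\in\{1,\dots,k\}$, $i\ge 0$, $(z_j)_i$ has range tree a right $n_1$-string of $\lfloor i/(n_1-1)\rfloor+1$ carets with an $n_j$-ary caret attached to the leaf numbered $i$, and domain tree the right $n_1$-string with the same number of leaves. The standard finite generating set is $X=\{(y_i)_0,\dots,(y_i)_{n_i-1}: 2\le i\le k\}\cup\{(z_j)_0,\dots,(z_j)_{n_j-1}:1\le j\le k\}$, and $|x|_X$ is the word length of $x$ with respect to $X$.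
   Formalization: It is additionally assumed that some n_j is not a power of n_1; otherwise (e.g. n_1=n_2=2) the group is F(n_1), where word length grows at least linearly in L(x), so the claimed sequence does not exist. *)

theory Defs
  imports "HOL-Analysis.Analysis" "HOL-Algebra.Bij"
begin

text \<open>
  Throughout, the parameters \<open>n\<^sub>1, \<dots>, n\<^sub>k\<close> are the values \<open>n 1, \<dots>, n k\<close>
  of a function \<open>n :: nat \<Rightarrow> nat\<close>; its other values are irrelevant.
\<close>

subsection \<open>The group\<close>

definition fractions_ring :: "nat \<Rightarrow> (nat \<Rightarrow> nat) \<Rightarrow> real set" where
  "fractions_ring k n = {of_int a / real (\<Prod>j\<in>{1..k}. n j) ^ e | (a::int) (e::nat). True}"

definition slope_group :: "nat \<Rightarrow> (nat \<Rightarrow> nat) \<Rightarrow> real set" where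
  "slope_group k n = {\<Prod>j\<in>{1..k}. real (n j) powi e j | e :: nat \<Rightarrow> int. True}"

text \<open>
  The finite set \<open>P\<close> contains all breakpoints (and possibly further points of the ring, in
  particular it may contain the end points of the unit interval).
\<close>

definition pl_map :: "nat \<Rightarrow> (nat \<Rightarrow> nat) \<Rightarrow> (real \<Rightarrow> real) \<Rightarrow> bool" where
  "pl_map k n f \<longleftrightarrow>
     (\<exists>P. finite P \<and> P \<subseteq> fractions_ring k n \<inter> {0..1} \<and>
       (\<forall>a b. 0 \<le> a \<and> a < b \<and> b \<le> 1 \<and> {a<..<b} \<inter> P = {} \<longrightarrow>
         (\<exists>s\<in>slope_group k n. \<forall>t\<in>{a..b}. f t = f a + s * (t - a))))"

text \<open>
  Elements are extensional functions (\<^const>\<open>undefined\<close> outside the unit interval), so that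
  equality in the group is equality of maps on the unit interval. The product of
  \<^const>\<open>BijGroup\<close> is \<open>x \<otimes> y = x \<circ> y\<close>.
\<close>

definition TS :: "nat \<Rightarrow> (nat \<Rightarrow> nat) \<Rightarrow> (real \<Rightarrow> real) monoid" where
  "TS k n = (BijGroup {0..1})
     \<lparr>carrier := {f \<in> Bij {0..1}. (\<exists>g. homeomorphism {0..1} {0..1} f g) \<and>
                    strict_mono_on {0..1} f \<and> pl_map k n f}\<rparr>"

subsection \<open>Trees and tree-pair diagrams\<close>

datatype tree = Leaf | Caret "tree list"

fun ary_tree :: "nat set \<Rightarrow> tree \<Rightarrow> bool" where
  "ary_tree N Leaf \<longleftrightarrow> True"
| "ary_tree N (Caret ts) \<longleftrightarrow> length ts \<in> N \<and> (\<forall>t\<in>set ts. ary_tree N t)"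

fun leaves :: "tree \<Rightarrow> nat" where
  "leaves Leaf = 1"
| "leaves (Caret ts) = sum_list (map leaves ts)"

lemma size_nth_termination [termination_simp]:
  "i < length ts \<Longrightarrow> size (ts ! i) < Suc (size_list size ts)"
  by (meson le_imp_less_Suc nth_mem order_refl size_list_estimation')

text \<open>
  End points of the leaf intervals, from left to right, of a tree whose root represents
  the interval from \<open>a\<close> to \<open>b\<close>.
\<close>

fun leaf_intervals :: "real \<Rightarrow> real \<Rightarrow> tree \<Rightarrow> (real \<times> real) list" where
  "leaf_intervals a b Leaf = [(a, b)]"
| "leaf_intervals a b (Caret ts) =
     concat (map (\<lambda>i. leaf_intervals
                        (a + real i * (b - a) / real (length ts))
                        (a + real (Suc i) * (b - a) / real (length ts)) (ts ! i))
                 [0..<length ts])"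

definition represents ::
    "nat \<Rightarrow> (nat \<Rightarrow> nat) \<Rightarrow> tree \<Rightarrow> tree \<Rightarrow> (real \<Rightarrow> real) \<Rightarrow> bool" where
  "represents k n D R x \<longleftrightarrow>
     ary_tree (n ` {1..k}) D \<and> ary_tree (n ` {1..k}) R \<and> leaves D = leaves R \<and>
     (\<forall>i<leaves D.
        let (a, b) = leaf_intervals 0 1 D ! i; (c, d) = leaf_intervals 0 1 R ! i
        in \<forall>t\<in>{a..b}. x t = c + (t - a) * (d - c) / (b - a))"

definition min_leaves :: "nat \<Rightarrow> (nat \<Rightarrow> nat) \<Rightarrow> (real \<Rightarrow> real) \<Rightarrow> nat" where
  "min_leaves k n x = (LEAST l. \<exists>D R. represents k n D R x \<and> leaves D = l)"

subsection \<open>The standard finite generating set\<close>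

fun right_string :: "nat \<Rightarrow> nat \<Rightarrow> tree" where
  "right_string p 0 = Leaf"
| "right_string p (Suc i) = Caret (replicate (p - 1) Leaf @ [right_string p i])"

text \<open>\<open>attach m i t\<close> attaches an \<open>m\<close>-ary caret to the leaf of \<open>t\<close> numbered \<open>i\<close> (from 0).\<close>

fun attach :: "nat \<Rightarrow> nat \<Rightarrow> tree \<Rightarrow> tree"
  and attach_list :: "nat \<Rightarrow> nat \<Rightarrow> tree list \<Rightarrow> tree list" where
  "attach m i Leaf = (if i = 0 then Caret (replicate m Leaf) else Leaf)"
| "attach m i (Caret ts) = Caret (attach_list m i ts)"
| "attach_list m i [] = []"
| "attach_list m i (t # ts) =
     (if i < leaves t then attach m i t # ts else t # attach_list m (i - leaves t) ts)"

text \<open>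
  The element with range tree \<open>R\<close> whose domain tree is a right \<open>n\<^sub>1\<close>-string; the number of
  carets \<open>d\<close> of that string is determined by the number of leaves of \<open>R\<close>.
\<close>

definition string_elt :: "nat \<Rightarrow> (nat \<Rightarrow> nat) \<Rightarrow> tree \<Rightarrow> real \<Rightarrow> real" where
  "string_elt k n R =
     (THE x. x \<in> carrier (TS k n) \<and> (\<exists>d. represents k n (right_string (n 1) d) R x))"

definition y_gen :: "nat \<Rightarrow> (nat \<Rightarrow> nat) \<Rightarrow> nat \<Rightarrow> nat \<Rightarrow> real \<Rightarrow> real" where
  "y_gen k n j i =
     string_elt k n (attach (n j) (leaves (right_string (n 1) i) - 1) (right_string (n 1) i))"

definition z_gen :: "nat \<Rightarrow> (nat \<Rightarrow> nat) \<Rightarrow> nat \<Rightarrow> nat \<Rightarrow> real \<Rightarrow> real" where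
  "z_gen k n j i =
     string_elt k n (attach (n j) i (right_string (n 1) (i div (n 1 - 1) + 1)))"

definition std_gens :: "nat \<Rightarrow> (nat \<Rightarrow> nat) \<Rightarrow> (real \<Rightarrow> real) set" where
  "std_gens k n = {y_gen k n j i | j i. j \<in> {2..k} \<and> i < n j}
                \<union> {z_gen k n j i | j i. j \<in> {1..k} \<and> i < n j}"

subsection \<open>Word length\<close>

text \<open>
  The infimum is taken in \<^typ>\<open>enat\<close>, so that it is infinite (rather than an arbitrary number)
  on elements outside the subgroup generated by \<open>X\<close>.
\<close>

definition word_length :: "('a, 'b) monoid_scheme \<Rightarrow> 'a set \<Rightarrow> 'a \<Rightarrow> enat" where
  "word_length G X x =
     (INF ws \<in> {ws. set ws \<subseteq> X \<union> m_inv G ` X \<and> foldr (mult G) ws (one G) = x}. enat (length ws))"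

end

theory Submission
  imports Defs
begin

text \<open>
  A diagram is handled through the lists of its leaf intervals, which arise from the unit
  interval by repeatedly cutting intervals into \<open>n\<^sub>j\<close> equal parts. Cutting into \<open>p\<close> and then
  into \<open>q\<close> parts is the same as cutting into \<open>q\<close> and then into \<open>p\<close> parts, so parallel
  cutting has the diamond property. Tiling gives common expansions in which the range tree of
  \<open>x\<close> grows at most by a factor depending only on \<open>g\<close>; hence \<open>L(g x) \<le> B L(x)\<close> for all
  generators \<open>g\<close> and their inverses, which is the lower bound.

  For sharpness take \<open>n\<^sub>j\<close> that is not a power of \<open>n\<^sub>1\<close>. A suitable word
  \<open>w = (z\<^sub>1)\<^sub>0\<^sup>-\<^sup>b (y\<^sub>j)\<^sub>0\<close> is multiplication by some \<open>n\<^sub>1\<^sup>a / n\<^sub>j < 1\<close>, with \<open>n\<^sub>1\<^sup>a\<close> not dividing \<open>n\<^sub>j\<close>,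
  on all of \<open>[0, 1/n\<^sub>1]\<close>. All leaf intervals have length \<open>1/q\<close> with \<open>q\<close> an integer. Hence, if \<open>A > 1\<close>
  is the reduced numerator of the slope, the length of a domain leaf of \<open>w\<^sup>m\<close> meeting
  \<open>[0, 1/n\<^sub>1)\<close> has a denominator divisible by \<open>A\<^sup>m\<close>, so the number of leaves is exponential in \<open>m\<close>.
\<close>

subsection \<open>Parallel subdivision of interval lists\<close>

text \<open>The end points are literally the formulas of \<open>leaf_intervals\<close>, which makes
  \<open>leaf_intervals_Caret\<close> an equality of lists.\<close>

definition parts :: "nat \<Rightarrow> real \<times> real \<Rightarrow> (real \<times> real) list" where
  "parts m I = map (\<lambda>i. (fst I + real i * (snd I - fst I) / real m,
                         fst I + real (Suc i) * (snd I - fst I) / real m)) [0..<m]"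

text \<open>One step cuts each interval at most once, like parallel reduction in Church-Rosser
  proofs: a peak closes with one step on either side, and a step multiplies the length by at most
  the largest arity.\<close>

inductive par :: "nat set \<Rightarrow> (real \<times> real) list \<Rightarrow> (real \<times> real) list \<Rightarrow> bool" for N where
  par_Nil: "par N [] []"
| par_keep: "par N K L \<Longrightarrow> par N (I # K) (I # L)"
| par_split: "m \<in> N \<Longrightarrow> par N K L \<Longrightarrow> par N (I # K) (parts m I @ L)"

lemma length_parts [simp]: "length (parts m I) = m"
  by (simp add: parts_def)

lemma concat_map_upt: "concat (map (\<lambda>i. map (\<lambda>j. i * q + j) [0..<q]) [0..<m]) = [0..<m * q]"
proof (induction m)
  case (Suc m)
  have "map (\<lambda>j. m * q + j) [0..<q] = [m * q..<m * q + q]"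
    using map_add_upt[of "m * q" q] by (simp add: add.commute)
  then show ?case
    using Suc upt_add_eq_append[of 0 "m * q" q] by (simp add: add.commute)
qed simp

text \<open>Piece \<open>j\<close> of piece \<open>i\<close> is piece \<open>i * q + j\<close> of
  the cut into \<open>m * q\<close> parts. The result is symmetric in \<open>m\<close> and
  \<open>q\<close>, so cuts of different arities commute.\<close>

lemma parts_parts:
  assumes "m > 0" "q > 0"
  shows "concat (map (parts q) (parts m I)) = parts (m * q) I"
proof -
  let ?h = "\<lambda>l. (fst I + real l * (snd I - fst I) / real (m * q),
                  fst I + real (Suc l) * (snd I - fst I) / real (m * q))"
  have "parts q (fst I + real i * (snd I - fst I) / real m,
                 fst I + real (Suc i) * (snd I - fst I) / real m)
        = map ?h (map (\<lambda>j. i * q + j) [0..<q])" for i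
    using assms by (auto simp: parts_def field_simps)
  then have "concat (map (parts q) (parts m I))
      = concat (map (\<lambda>i. map ?h (map (\<lambda>j. i * q + j) [0..<q])) [0..<m])"
    by (simp only: parts_def[of m] map_map o_def)
  also have "\<dots> = map ?h (concat (map (\<lambda>i. map (\<lambda>j. i * q + j) [0..<q]) [0..<m]))"
    by (simp only: map_concat map_map o_def)
  also have "\<dots> = parts (m * q) I"
    by (simp only: concat_map_upt) (simp add: parts_def)
  finally show ?thesis .
qed

lemma par_refl: "par N K K"
  by (induction K) (auto intro: par.intros)

lemma par_append: "par N K L \<Longrightarrow> par N K' L' \<Longrightarrow> par N (K @ K') (L @ L')"
  by (induction rule: par.induct) (auto intro: par.intros)

lemma par_split_all: "q \<in> N \<Longrightarrow> par N K (concat (map (parts q) K))"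
  by (induction K) (auto intro: par.intros)

lemma par_parts: "q \<in> N \<Longrightarrow> m > 0 \<Longrightarrow> q > 0 \<Longrightarrow> par N (parts m I) (parts (m * q) I)"
  using par_split_all[of q N "parts m I"] by (simp add: parts_parts)

text \<open>Work interval by interval: if one side keeps and the other cuts, the keeping side
  catches up; if the sides cut into \<open>m\<close> and \<open>q\<close> parts, both go on to
  \<open>m * q\<close> parts.\<close>

lemma par_diamond:
  assumes "0 \<notin> N" "par N K L" "par N K L'"
  shows "\<exists>M. par N L M \<and> par N L' M"
  using assms(2,3)
proof (induction arbitrary: L' rule: par.induct)
  case par_Nil
  then show ?case using par_refl by blast
next
  case (par_keep K L I)
  note IH = par_keep.IH
  from par_keep.prems show ?case
  proof cases
    case (par_keep L'')
    with IH obtain M where "par N L M" "par N L'' M" by blast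
    then show ?thesis using par_keep by (auto intro: par.intros)
  next
    case (par_split m L'')
    with IH obtain M where "par N L M" "par N L'' M" by blast
    then show ?thesis
      using par_split by (metis par.par_split par_append par_refl)
  qed
next
  case (par_split m K L I)
  note IH = par_split.IH
  from par_split.prems show ?case
  proof cases
    case (par_keep L'')
    with IH obtain M where "par N L M" "par N L'' M" by blast
    then show ?thesis
      using par_keep par_split by (metis par.par_split par_append par_refl)
  next
    case (par_split q L'')
    with IH obtain M where M: "par N L M" "par N L'' M" by blast
    have "m > 0" "q > 0" using assms(1) \<open>m \<in> N\<close> \<open>q \<in> N\<close> by (auto intro: gr0I)
    then have "par N (parts m I) (parts (m * q) I)" "par N (parts q I) (parts (m * q) I)"
      using par_parts[of q N m I] par_parts[of m N q I] \<open>m \<in> N\<close> \<open>q \<in> N\<close>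
      by (auto simp: mult.commute)
    then show ?thesis using M par_split par_append by blast
  qed
qed

lemma par_strip:
  assumes "0 \<notin> N" "(par N ^^ r) K L" "par N K L'"
  shows "\<exists>M. par N L M \<and> (par N ^^ r) L' M"
  using assms(2)
proof (induction r arbitrary: L)
  case 0
  then show ?case using assms(3) by auto
next
  case (Suc r)
  then obtain L0 where "(par N ^^ r) K L0" "par N L0 L" by auto
  with Suc.IH obtain M0 where "par N L0 M0" "(par N ^^ r) L' M0" by blast
  with par_diamond[OF assms(1) \<open>par N L0 L\<close>] show ?case by fastforce
qed

text \<open>The tiling is completed strip by strip, one strip per step from \<open>K\<close> to
  \<open>L'\<close>. The side opposite the \<open>r\<close> steps again has exactly \<open>r\<close>
  steps, however long the derivation of \<open>L'\<close> is; this is the source of the growth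
  bound.\<close>

lemma par_tile:
  assumes "0 \<notin> N" "(par N ^^ r) K L" "(par N)\<^sup>*\<^sup>* K L'"
  shows "\<exists>M. (par N)\<^sup>*\<^sup>* L M \<and> (par N ^^ r) L' M"
  using assms(3)
proof (induction rule: rtranclp_induct)
  case base
  then show ?case using assms(2) by blast
next
  case (step L1 L2)
  then obtain M where "(par N)\<^sup>*\<^sup>* L M" "(par N ^^ r) L1 M" by blast
  with par_strip[OF assms(1) _ step.hyps(2)] show ?case
    by (meson rtranclp.rtrancl_into_rtrancl)
qed

lemma length_par:
  assumes "\<And>m. m \<in> N \<Longrightarrow> m \<le> b" "b \<ge> 1" "par N K L"
  shows "length L \<le> b * length K"
  using assms(3) assms(1,2) by (induction rule: par.induct) (auto simp: add_mono)

lemma length_relpowp_par: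
  assumes "\<And>m. m \<in> N \<Longrightarrow> m \<le> b" "b \<ge> 1" "(par N ^^ r) K L"
  shows "length L \<le> b ^ r * length K"
  using assms(3)
proof (induction r arbitrary: L)
  case (Suc r)
  then obtain L0 where L0: "(par N ^^ r) K L0" "par N L0 L" by auto
  have "length L \<le> b * length L0" using length_par[OF assms(1,2) L0(2)] by blast
  also have "\<dots> \<le> b * (b ^ r * length K)" using Suc.IH[OF L0(1)] by (rule mult_left_mono) simp
  finally show ?case by (simp add: mult.assoc)
qed auto

lemma par_rtranclp_append:
  assumes "(par N)\<^sup>*\<^sup>* K L" "(par N)\<^sup>*\<^sup>* K' L'"
  shows "(par N)\<^sup>*\<^sup>* (K @ K') (L @ L')"
proof -
  have "(par N)\<^sup>*\<^sup>* (K @ K') (L @ K')" using assms(1)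
    by (induction rule: rtranclp_induct) (auto intro: rtranclp.rtrancl_into_rtrancl par_append par_refl)
  moreover have "(par N)\<^sup>*\<^sup>* (L @ K') (L @ L')" using assms(2)
    by (induction rule: rtranclp_induct) (auto intro: rtranclp.rtrancl_into_rtrancl par_append par_refl)
  ultimately show ?thesis by simp
qed

lemma par_rtranclp_concat:
  "list_all2 (\<lambda>I L. (par N)\<^sup>*\<^sup>* [I] L) K Ls \<Longrightarrow> (par N)\<^sup>*\<^sup>* K (concat Ls)"
proof (induction rule: list_all2_induct)
  case (Cons I K L Ls)
  then show ?case using par_rtranclp_append[of N "[I]" L] by simp
qed simp

lemma par_append_left_cases:
  "par N (K @ K') M \<Longrightarrow> \<exists>L L'. M = L @ L' \<and> par N K L \<and> par N K' L'"
proof (induction K arbitrary: M)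
  case Nil
  then show ?case using par_Nil by fastforce
next
  case (Cons I K)
  from Cons.prems have "par N (I # (K @ K')) M" by simp
  then show ?case
  proof cases
    case (par_keep L)
    with Cons.IH obtain L1 L2 where "L = L1 @ L2" "par N K L1" "par N K' L2" by blast
    then show ?thesis using par_keep
      by (intro exI[of _ "I # L1"] exI[of _ L2]) (auto intro: par.intros)
  next
    case (par_split m L)
    with Cons.IH obtain L1 L2 where "L = L1 @ L2" "par N K L1" "par N K' L2" by blast
    then show ?thesis using par_split
      by (intro exI[of _ "parts m I @ L1"] exI[of _ L2]) (auto intro: par.intros)
  qed
qed

text \<open>Serves to distribute a step on the leaves of a caret among its subtrees.\<close>

lemma par_concat_cases:
  "par N (concat Ls) M \<Longrightarrow> \<exists>Ms. M = concat Ms \<and> list_all2 (par N) Ls Ms"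
proof (induction Ls arbitrary: M)
  case Nil
  then show ?case by (auto elim: par.cases)
next
  case (Cons L Ls)
  then obtain M1 M2 where "M = M1 @ M2" "par N L M1" "par N (concat Ls) M2"
    using par_append_left_cases[of N L "concat Ls" M] by auto
  with Cons.IH show ?case by (metis concat.simps(2) list_all2_Cons)
qed

subsection \<open>Trees as iterated subdivisions\<close>

lemma leaf_intervals_Caret:
  "leaf_intervals a b (Caret ts) =
     concat (map2 (\<lambda>I t. leaf_intervals (fst I) (snd I) t) (parts (length ts) (a, b)) ts)"
  (is "_ = concat (map2 ?g ?P ts)")
proof -
  have "map2 ?g ?P ts = map (\<lambda>i. ?g (?P ! i) (ts ! i)) [0..<length ts]"
    by (rule nth_equalityI) auto
  also have "\<dots> = map (\<lambda>i. leaf_intervals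
                        (a + real i * (b - a) / real (length ts))
                        (a + real (Suc i) * (b - a) / real (length ts)) (ts ! i))
                 [0..<length ts]"
    by (rule map_cong) (auto simp: parts_def)
  finally show ?thesis by simp
qed

lemma length_leaf_intervals: "length (leaf_intervals a b t) = leaves t"
proof (induction t arbitrary: a b)
  case (Caret ts)
  have "map length (map2 (\<lambda>I t. leaf_intervals (fst I) (snd I) t) (parts (length ts) (a, b)) ts)
        = map leaves ts"
    using Caret by (intro nth_equalityI) auto
  then show ?case by (simp only: leaf_intervals_Caret length_concat leaves.simps)
qed simp

lemma par_leaf_intervals:
  "ary_tree N t \<Longrightarrow> (par N)\<^sup>*\<^sup>* [(a, b)] (leaf_intervals a b t)"
proof (induction t arbitrary: a b)
  case (Caret ts)
  have "par N [(a, b)] (parts (length ts) (a, b))"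
    using par_split[OF _ par_Nil, of "length ts" N "(a, b)"] Caret.prems by simp
  moreover have "(par N)\<^sup>*\<^sup>* [I] (leaf_intervals (fst I) (snd I) t)" if "t \<in> set ts" for I t
    using Caret.IH[OF that, of "fst I" "snd I"] Caret.prems that by simp
  then have "(par N)\<^sup>*\<^sup>* (parts (length ts) (a, b)) (leaf_intervals a b (Caret ts))"
    unfolding leaf_intervals_Caret
    by (intro par_rtranclp_concat) (simp add: list_all2_conv_all_nth)
  ultimately show ?case by (meson converse_rtranclp_into_rtranclp)
qed simp

lemma parts_eq_leaf_intervals:
  "parts m (a, b) = leaf_intervals a b (Caret (replicate m Leaf))"
proof -
  have "map2 (\<lambda>I t. leaf_intervals (fst I) (snd I) t) (parts m (a, b)) (replicate m Leaf)
        = map (\<lambda>I. [I]) (parts m (a, b))"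
    by (intro nth_equalityI) auto
  then show ?thesis
    using leaf_intervals_Caret[of a b "replicate m Leaf"] by (simp add: concat_map_singleton[of id, simplified])
qed

text \<open>Cutting leaf intervals means attaching carets at leaves, which is done separately in
  each subtree of the root. Hence the lists produced by tiling come from trees again.\<close>

lemma par_leaf_intervals_tree:
  "ary_tree N t \<Longrightarrow> par N (leaf_intervals a b t) K
    \<Longrightarrow> \<exists>u. ary_tree N u \<and> K = leaf_intervals a b u"
proof (induction t arbitrary: a b K)
  case Leaf
  from Leaf.prems(2) have "par N [(a, b)] K" by simp
  then show ?case
  proof cases
    case (par_keep L)
    then show ?thesis by (intro exI[of _ Leaf]) (auto elim: par.cases)
  next
    case (par_split m L)
    then have "L = []" by (auto elim: par.cases)
    then show ?thesis using par_split
      by (intro exI[of _ "Caret (replicate m Leaf)"]) (simp add: parts_eq_leaf_intervals del: leaf_intervals.simps)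
  qed
next
  case (Caret ts)
  let ?m = "length ts" and ?P = "parts (length ts) (a, b)"
  from Caret.prems(2) obtain Ms where Ms: "K = concat Ms"
    "list_all2 (par N) (map2 (\<lambda>I t. leaf_intervals (fst I) (snd I) t) ?P ts) Ms"
    unfolding leaf_intervals_Caret using par_concat_cases by blast
  have len: "length Ms = ?m" using Ms(2) by (auto dest: list_all2_lengthD)
  have "\<exists>u. ary_tree N u \<and> Ms ! i = leaf_intervals (fst (?P ! i)) (snd (?P ! i)) u" if "i < ?m" for i
    using Caret.IH[of "ts ! i"] Caret.prems(1) Ms(2) that len
    by (auto simp: list_all2_conv_all_nth)
  then obtain u where u: "\<And>i. i < ?m \<Longrightarrow>
      ary_tree N (u i) \<and> Ms ! i = leaf_intervals (fst (?P ! i)) (snd (?P ! i)) (u i)"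
    by metis
  let ?us = "map u [0..<?m]"
  have "Ms = map2 (\<lambda>I t. leaf_intervals (fst I) (snd I) t) (parts (length ?us) (a, b)) ?us"
    using u len by (intro nth_equalityI) auto
  then have "K = leaf_intervals a b (Caret ?us)"
    by (simp only: leaf_intervals_Caret Ms(1))
  moreover have "ary_tree N (Caret ?us)" using u Caret.prems(1) by auto
  ultimately show ?case by blast
qed

lemma par_rtranclp_leaf_intervals_tree:
  assumes "(par N)\<^sup>*\<^sup>* (leaf_intervals a b t) K" "ary_tree N t"
  shows "\<exists>u. ary_tree N u \<and> K = leaf_intervals a b u"
  using assms
proof (induction rule: rtranclp_induct)
  case base
  then show ?case by blast
next
  case (step K L)
  then show ?case using par_leaf_intervals_tree by blast
qed

subsection \<open>Invariants of subdivisions\<close>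

text \<open>Encodes a partition of [a,b] into consecutive intervals; strictness makes later
  divisions by lengths meaningful.\<close>

fun chain :: "real \<Rightarrow> (real \<times> real) list \<Rightarrow> real \<Rightarrow> bool" where
  "chain a [] b \<longleftrightarrow> a = b"
| "chain a (I # K) b \<longleftrightarrow> fst I = a \<and> a < snd I \<and> chain (snd I) K b"

lemma chain_append: "chain a (K @ L) b \<longleftrightarrow> (\<exists>c. chain a K c \<and> chain c L b)"
  by (induction K arbitrary: a) auto

lemma chain_le: "chain a K b \<Longrightarrow> a \<le> b"
  by (induction K arbitrary: a) force+

lemma chain_map_upt:
  "(\<And>i. i < m \<Longrightarrow> h i < h (Suc i)) \<Longrightarrow> chain (h 0) (map (\<lambda>i. (h i, h (Suc i))) [0..<m]) (h m)"
  by (induction m) (auto simp: chain_append)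

lemma chain_parts:
  assumes "m > 0" "fst I < snd I"
  shows "chain (fst I) (parts m I) (snd I)"
proof -
  let ?h = "\<lambda>i. fst I + real i * (snd I - fst I) / real m"
  have "?h i < ?h (Suc i)" for i
    using assms by (simp add: divide_strict_right_mono)
  then show ?thesis
    using chain_map_upt[of m ?h] assms by (simp add: parts_def)
qed

lemma chain_par: "par N K L \<Longrightarrow> 0 \<notin> N \<Longrightarrow> chain a K b \<Longrightarrow> chain a L b"
proof (induction arbitrary: a rule: par.induct)
  case (par_split m K L I)
  then show ?case using chain_parts[of m I] by (auto simp: chain_append intro: gr0I)
qed auto

lemma chain_leaf_intervals:
  assumes "ary_tree N t" "0 \<notin> N" "a < b"
  shows "chain a (leaf_intervals a b t) b"
  using par_leaf_intervals[OF assms(1)]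
proof (induction rule: rtranclp_induct)
  case base
  then show ?case using assms by simp
next
  case (step K L)
  then show ?case using chain_par assms(2) by blast
qed

lemma chain_nondeg: "chain a K b \<Longrightarrow> I \<in> set K \<Longrightarrow> fst I < snd I"
  by (induction K arbitrary: a) auto

lemma chain_bounds: "chain a K b \<Longrightarrow> I \<in> set K \<Longrightarrow> a \<le> fst I \<and> snd I \<le> b"
proof (induction K arbitrary: a)
  case (Cons J K)
  then show ?case using chain_le[of "snd J" K b] by fastforce
qed simp

text \<open>The first interval whose right end exceeds \<open>a\<close> must reach \<open>b\<close>,
  since its right end cannot lie strictly between. This locates the affine piece demanded by
  \<open>pl_map\<close>.\<close>

lemma chain_no_endpoint:
  assumes "chain p K q" "p \<le> a" "a < b" "b \<le> q"
    and "{a<..<b} \<inter> (fst ` set K \<union> snd ` set K) = {}"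
  shows "\<exists>I\<in>set K. fst I \<le> a \<and> b \<le> snd I"
  using assms
proof (induction K arbitrary: p)
  case (Cons I K)
  show ?case
  proof (cases "snd I \<le> a")
    case True
    then show ?thesis using Cons by auto
  next
    case False
    then have "b \<le> snd I" using Cons.prems(5) by auto
    then show ?thesis using Cons.prems by auto
  qed
qed auto

text \<open>The intervals starting left of \<open>c\<close> cover [p,c], so short ones must be
  numerous. This converts short leaves into many leaves.\<close>

lemma chain_cover:
  assumes "chain p K q" "p \<le> c" "c \<le> q" "\<delta> \<ge> 0"
    and "\<And>I. I \<in> set K \<Longrightarrow> fst I < c \<Longrightarrow> snd I - fst I \<le> \<delta>"
  shows "c - p \<le> real (length K) * \<delta>"
  using assms
proof (induction K arbitrary: p)
  case (Cons I K)
  have "fst I = p" using Cons.prems by simp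
  show ?case
  proof (cases "p < c")
    case False
    then show ?thesis using Cons.prems by (auto intro: order_trans[of _ 0])
  next
    case True
    then have 1: "snd I - p \<le> \<delta>" using Cons.prems(5)[of I] \<open>fst I = p\<close> by simp
    show ?thesis
    proof (cases "snd I \<le> c")
      case True
      then have "c - snd I \<le> real (length K) * \<delta>" using Cons by auto
      then show ?thesis using 1 by (simp add: algebra_simps)
    next
      case False
      have "real (length K) * \<delta> \<ge> 0" using Cons.prems by simp
      then show ?thesis using 1 False by (simp add: algebra_simps)
    qed
  qed
qed simp

subsection \<open>Maps that are affine between corresponding intervals\<close>

text \<open>Nondegeneracy of both intervals is built in, so \<open>list_all2 (aff x)\<close> can
  replace a tree pair and makes sense for arbitrary interval lists.\<close>

definition aff :: "(real \<Rightarrow> real) \<Rightarrow> real \<times> real \<Rightarrow> real \<times> real \<Rightarrow> bool" where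
  "aff x I J \<longleftrightarrow> fst I < snd I \<and> fst J < snd J \<and>
     (\<forall>t\<in>{fst I..snd I}. x t = fst J + (t - fst I) * (snd J - fst J) / (snd I - fst I))"

lemma aff_parts:
  assumes "aff x I J" "m > 0"
  shows "list_all2 (aff x) (parts m I) (parts m J)"
proof -
  obtain a b c d where IJ: "I = (a, b)" "J = (c, d)" by fastforce
  have ab: "a < b" "c < d" and x: "\<And>t. a \<le> t \<Longrightarrow> t \<le> b \<Longrightarrow> x t = c + (t - a) * (d - c) / (b - a)"
    using assms by (auto simp: aff_def IJ)
  have "aff x (a + real i * (b - a) / real m, a + real (Suc i) * (b - a) / real m)
              (c + real i * (d - c) / real m, c + real (Suc i) * (d - c) / real m)"
    (is "aff x (?a, ?b) (?c, ?d)") if "i < m" for i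
  proof -
    have len: "?b - ?a = (b - a) / real m" "?d - ?c = (d - c) / real m"
      using assms(2) by (simp_all add: field_simps)
    have pos: "(b - a) / real m > 0" "(d - c) / real m > 0" using assms(2) ab by simp_all
    have "real i * (b - a) / real m \<ge> 0" using ab by simp
    then have "a \<le> ?a" by simp
    have "real (Suc i) * (b - a) / real m \<le> real m * (b - a) / real m"
      using that ab by (intro divide_right_mono mult_right_mono) auto
    then have "?b \<le> b" using assms(2) by simp
    have "x t = ?c + (t - ?a) * (?d - ?c) / (?b - ?a)" if "?a \<le> t" "t \<le> ?b" for t
    proof -
      \<comment> \<open>Both lengths shrink by the factor \<open>m\<close>, so the slope is
        unchanged.\<close>
      have "(?d - ?c) / (?b - ?a) = (d - c) / (b - a)"
        unfolding len using assms(2) by simp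
      then have "?c + (t - ?a) * (?d - ?c) / (?b - ?a) = ?c + (t - ?a) * ((d - c) / (b - a))"
        by (metis times_divide_eq_right)
      also have "\<dots> = c + (t - a) * (d - c) / (b - a)"
        using ab assms(2) by (simp add: field_simps)
      finally show ?thesis using x[of t] that \<open>a \<le> ?a\<close> \<open>?b \<le> b\<close> by simp
    qed
    moreover have "?a < ?b" "?c < ?d" using len pos by linarith+
    ultimately show ?thesis by (simp add: aff_def)
  qed
  then show ?thesis
    by (simp add: list_all2_conv_all_nth parts_def IJ)
qed

text \<open>Each cut on the domain side is copied to the matching range interval, which is the
  expansion of a diagram; \<open>par_aff_right\<close> starts from the range side instead.\<close>

lemma par_aff_left:
  assumes "par N K K'" "list_all2 (aff x) K L" "0 \<notin> N"
  shows "\<exists>L'. par N L L' \<and> list_all2 (aff x) K' L'"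
  using assms
proof (induction arbitrary: L rule: par.induct)
  case par_Nil
  then show ?case by (auto intro: par.intros)
next
  case (par_keep K K' I)
  then obtain J L1 where "L = J # L1" "aff x I J" "list_all2 (aff x) K L1"
    by (auto simp: list_all2_Cons1)
  with par_keep show ?case by (metis list_all2_Cons par.par_keep)
next
  case (par_split m K K' I)
  then obtain J L1 where J: "L = J # L1" "aff x I J" "list_all2 (aff x) K L1"
    by (auto simp: list_all2_Cons1)
  have "m > 0" using par_split by (auto intro: gr0I)
  from J par_split obtain L' where "par N L1 L'" "list_all2 (aff x) K' L'" by blast
  with J par_split show ?case
    using aff_parts[OF J(2) \<open>m > 0\<close>] by (metis list_all2_appendI par.par_split)
qed

lemma par_aff_right:
  assumes "par N L L'" "list_all2 (aff x) K L" "0 \<notin> N"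
  shows "\<exists>K'. par N K K' \<and> list_all2 (aff x) K' L'"
  using assms
proof (induction arbitrary: K rule: par.induct)
  case par_Nil
  then show ?case by (auto intro: par.intros)
next
  case (par_keep L L' J)
  then obtain I K1 where "K = I # K1" "aff x I J" "list_all2 (aff x) K1 L"
    by (auto simp: list_all2_Cons2)
  with par_keep show ?case by (metis list_all2_Cons par.par_keep)
next
  case (par_split m L L' J)
  then obtain I K1 where J: "K = I # K1" "aff x I J" "list_all2 (aff x) K1 L"
    by (auto simp: list_all2_Cons2)
  have "m > 0" using par_split by (auto intro: gr0I)
  from J par_split obtain K' where "par N K1 K'" "list_all2 (aff x) K' L'" by blast
  with J par_split show ?case
    using aff_parts[OF J(2) \<open>m > 0\<close>] by (metis list_all2_appendI par.par_split)
qed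

lemma par_rtranclp_aff_left:
  assumes "(par N)\<^sup>*\<^sup>* K K'" "list_all2 (aff x) K L" "0 \<notin> N"
  shows "\<exists>L'. (par N)\<^sup>*\<^sup>* L L' \<and> list_all2 (aff x) K' L'"
  using assms(1)
proof (induction rule: rtranclp_induct)
  case base
  then show ?case using assms by blast
next
  case (step K1 K2)
  then show ?case using par_aff_left assms(3) by (meson rtranclp.rtrancl_into_rtrancl)
qed

lemma par_rtranclp_aff_right:
  assumes "(par N)\<^sup>*\<^sup>* L L'" "list_all2 (aff x) K L" "0 \<notin> N"
  shows "\<exists>K'. (par N)\<^sup>*\<^sup>* K K' \<and> list_all2 (aff x) K' L'"
  using assms(1)
proof (induction rule: rtranclp_induct)
  case base
  then show ?case using assms by blast
next
  case (step L1 L2)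
  then show ?case using par_aff_right assms(3) by (meson rtranclp.rtrancl_into_rtrancl)
qed

lemma aff_range:
  assumes "aff x I J" "t \<in> {fst I..snd I}"
  shows "x t \<in> {fst J..snd J}"
proof -
  have pos: "snd I - fst I > 0" "snd J - fst J > 0" using assms by (auto simp: aff_def)
  have "(t - fst I) * (snd J - fst J) / (snd I - fst I) \<ge> 0" using assms pos by simp
  moreover have "(t - fst I) * (snd J - fst J) \<le> (snd J - fst J) * (snd I - fst I)"
    using assms pos by (simp add: mult.commute mult_right_mono)
  then have "(t - fst I) * (snd J - fst J) / (snd I - fst I) \<le> snd J - fst J"
    using pos by (simp add: pos_divide_le_eq)
  ultimately show ?thesis using assms by (simp add: aff_def)
qed

lemma aff_compose:
  assumes "aff x I J" "aff g J L" "\<And>t. t \<in> {fst I..snd I} \<Longrightarrow> y t = g (x t)"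
  shows "aff y I L"
proof -
  have "y t = fst L + (t - fst I) * (snd L - fst L) / (snd I - fst I)"
    if t: "t \<in> {fst I..snd I}" for t
  proof -
    have "y t = fst L + (x t - fst J) * (snd L - fst L) / (snd J - fst J)"
      using assms(2,3) aff_range[OF assms(1) t] t by (simp add: aff_def)
    also have "x t - fst J = (t - fst I) * (snd J - fst J) / (snd I - fst I)"
      using assms(1) t by (simp add: aff_def)
    finally show ?thesis using assms by (simp add: aff_def)
  qed
  then show ?thesis using assms by (simp add: aff_def)
qed

lemma aff_inverse:
  assumes "aff x I J" "\<And>t. t \<in> {fst I..snd I} \<Longrightarrow> y (x t) = t"
  shows "aff y J I"
proof -
  have pos: "snd I - fst I > 0" "snd J - fst J > 0" using assms by (auto simp: aff_def)
  have "y u = fst I + (u - fst J) * (snd I - fst I) / (snd J - fst J)"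
    if u: "u \<in> {fst J..snd J}" for u
  proof -
    let ?t = "fst I + (u - fst J) * (snd I - fst I) / (snd J - fst J)"
    have "(u - fst J) * (snd I - fst I) / (snd J - fst J) \<ge> 0" using u pos by simp
    moreover have "(u - fst J) * (snd I - fst I) \<le> (snd I - fst I) * (snd J - fst J)"
      using u pos by (simp add: mult.commute mult_right_mono)
    then have "(u - fst J) * (snd I - fst I) / (snd J - fst J) \<le> snd I - fst I"
      using pos by (simp add: pos_divide_le_eq)
    ultimately have t: "?t \<in> {fst I..snd I}" by simp
    then have "x ?t = fst J + (?t - fst I) * (snd J - fst J) / (snd I - fst I)"
      using assms(1) by (simp add: aff_def)
    also have "\<dots> = u" using pos by simp
    finally show ?thesis using assms(2)[OF t] by simp
  qed
  then show ?thesis using assms(1) by (simp add: aff_def)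
qed

lemma aff_slope:
  assumes "aff x I J" "u \<in> {fst I..snd I}" "v \<in> {fst I..snd I}"
  shows "x v = x u + (snd J - fst J) / (snd I - fst I) * (v - u)"
proof -
  have "x v - x u = (v - fst I) * (snd J - fst J) / (snd I - fst I)
                     - (u - fst I) * (snd J - fst J) / (snd I - fst I)"
    using assms by (simp add: aff_def)
  also have "\<dots> = (snd J - fst J) / (snd I - fst I) * (v - u)"
    by (simp add: diff_divide_distrib[symmetric]) (simp add: algebra_simps)
  finally show ?thesis by simp
qed

text \<open>The clause \<open>x a = c\<close> strengthens the induction: it makes the tail map agree
  with the first affine piece at their common point \<open>snd I\<close>.\<close>

lemma chain_aff_exists:
  assumes "chain a K b" "chain c L d" "length K = length L"
  shows "\<exists>x. x a = c \<and> list_all2 (aff x) K L"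
  using assms
proof (induction K arbitrary: a c L)
  case Nil
  then show ?case by auto
next
  case (Cons I K)
  then obtain J L' where L: "L = J # L'" by (cases L) auto
  from Cons L obtain x where x: "x (snd I) = snd J" "list_all2 (aff x) K L'"
    by fastforce
  define y where "y t = (if t \<le> snd I then fst J + (t - fst I) * (snd J - fst J) / (snd I - fst I)
                        else x t)" for t
  have "aff y I J" using Cons.prems L by (auto simp: aff_def y_def)
  moreover have "list_all2 (aff y) K L'"
  proof (rule list.rel_mono_strong[OF x(2)])
    fix I' J' assume "I' \<in> set K" "aff x I' J'"
    then have "snd I \<le> fst I'"
      using chain_bounds[of "snd I" K b I'] Cons.prems by auto
    moreover have "y t = x t" if "snd I \<le> t" for t
      using that x(1) Cons.prems(1,2) L by (cases "t = snd I") (auto simp: y_def)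
    ultimately show "aff y I' J'" using \<open>aff x I' J'\<close> by (auto simp: aff_def)
  qed
  ultimately show ?case using Cons.prems L by (auto simp: y_def intro!: exI[of _ y])
qed

lemma strict_mono_on_Un_touch:
  fixes x :: "real \<Rightarrow> real"
  assumes "strict_mono_on {a..c} x" "strict_mono_on {c..b} x" "a \<le> c" "c \<le> b"
  shows "strict_mono_on {a..b} x"
proof (rule strict_mono_onI)
  fix u v assume uv: "u \<in> {a..b}" "v \<in> {a..b}" "u < v"
  have m: "x u < x v" if "u \<in> {p..q}" "v \<in> {p..q}" "u < v" "strict_mono_on {p..q} x" for p q u v
    using that by (meson strict_mono_onD)
  consider "v \<le> c" | "c \<le> u" | "u < c" "c < v" by linarith
  then show "x u < x v"
  proof cases
    case 1
    then show ?thesis using m[of u a c v] uv assms by auto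
  next
    case 2
    then show ?thesis using m[of u c b v] uv assms by auto
  next
    case 3
    then have "x u < x c" "x c < x v" using m[of u a c c] m[of c c b v] uv assms by auto
    then show ?thesis by simp
  qed
qed

text \<open>Each affine piece is increasing, onto and continuous, and neighbouring pieces share
  their value at \<open>snd I\<close>, so the three properties glue along the chain.\<close>

lemma chain_aff_homeo:
  assumes "chain a K b" "chain c L d" "list_all2 (aff x) K L" "x a = c"
  shows "strict_mono_on {a..b} x \<and> x ` {a..b} = {c..d} \<and> continuous_on {a..b} x"
  using assms
proof (induction K arbitrary: a c L)
  case Nil
  then show ?case by (auto intro: strict_mono_onI)
next
  case (Cons I K)
  then obtain J L' where L: "L = J # L'" "aff x I J" "list_all2 (aff x) K L'"
    by (auto simp: list_all2_Cons1)
  have ends: "fst I = a" "fst J = c" "a < snd I" "c < snd J" using Cons.prems L by auto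
  have le: "snd I \<le> b" "snd J \<le> d" using Cons.prems L chain_le by auto
  define s where "s = (snd J - fst J) / (snd I - fst I)"
  have "s > 0" using ends by (simp add: s_def)
  have x: "x t = c + s * (t - a)" if "t \<in> {a..snd I}" for t
    using aff_slope[OF L(2), of a t] that ends Cons.prems(4) by (simp add: s_def)
  have xe: "x (snd I) = snd J" using x[of "snd I"] ends by (simp add: s_def)
  have IH: "strict_mono_on {snd I..b} x" "x ` {snd I..b} = {snd J..d}" "continuous_on {snd I..b} x"
    using Cons.IH[of "snd I" "snd J" L'] Cons.prems L xe by auto
  have mono1: "strict_mono_on {a..snd I} x"
    using x \<open>s > 0\<close> by (intro strict_mono_onI) simp
  have cont1: "continuous_on {a..snd I} x"
    by (rule continuous_on_eq[of _ "\<lambda>t. c + s * (t - a)"]) (auto simp: x intro!: continuous_intros)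
  have "x ` {a..snd I} = {c..snd J}"
  proof
    show "x ` {a..snd I} \<subseteq> {c..snd J}" using aff_range[OF L(2)] ends by auto
    show "{c..snd J} \<subseteq> x ` {a..snd I}"
      using IVT'[of x a _ "snd I"] Cons.prems(4) xe cont1 ends by fastforce
  qed
  moreover have "{a..b} = {a..snd I} \<union> {snd I..b}" "{c..d} = {c..snd J} \<union> {snd J..d}"
    using ends le by auto
  ultimately show ?case
    using IH mono1 cont1 strict_mono_on_Un_touch[of a "snd I" x b] ends le
    by (simp add: image_Un continuous_on_closed_Un)
qed

subsection \<open>Strings and attached carets\<close>

lemma sum_list_leaves_mod:
  assumes "\<And>t. t \<in> set ts \<Longrightarrow> \<exists>d. leaves t = 1 + d * p"
  shows "\<exists>d. sum_list (map leaves ts) = length ts + d * p"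
  using assms
proof (induction ts)
  case (Cons t ts)
  then obtain d e where "leaves t = 1 + d * p" "sum_list (map leaves ts) = length ts + e * p"
    by (metis list.set_intros)
  then have "sum_list (map leaves (t # ts)) = length (t # ts) + (d + e) * p"
    by (simp add: algebra_simps)
  then show ?case by blast
qed simp

lemma leaves_right_string: "p > 0 \<Longrightarrow> leaves (right_string p d) = 1 + d * (p - 1)"
  by (induction d) (simp_all add: sum_list_replicate map_replicate_const)

lemma ary_tree_right_string: "p \<in> N \<Longrightarrow> p > 0 \<Longrightarrow> ary_tree N (right_string p d)"
  by (induction d) auto

lemma ary_tree_attach:
  assumes "m \<in> N"
  shows "ary_tree N t \<Longrightarrow> ary_tree N (attach m i t)"
    and "\<forall>t\<in>set ts. ary_tree N t \<Longrightarrow>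
      length (attach_list m i ts) = length ts \<and> (\<forall>t\<in>set (attach_list m i ts). ary_tree N t)"
  using assms
  by (induction m i t and m i ts rule: attach_attach_list.induct) auto

text \<open>The generators are studied near 0, where the leftmost leaves of their trees decide.
  Nonemptiness places the head of the concatenation in the first subtree.\<close>

lemma hd_leaf_intervals_Caret:
  assumes "leaf_intervals a (a + (b - a) / real (Suc (length ts))) t \<noteq> []"
  shows "hd (leaf_intervals a b (Caret (t # ts)))
       = hd (leaf_intervals a (a + (b - a) / real (Suc (length ts))) t)"
proof -
  have "parts (Suc (length ts)) (a, b) \<noteq> []" by (metis length_parts list.size(3) nat.distinct(1))
  then obtain I K where P: "parts (length (t # ts)) (a, b) = I # K" by (cases "parts (length (t # ts)) (a, b)") auto
  moreover have "parts (length (t # ts)) (a, b) ! 0 = (a, a + (b - a) / real (Suc (length ts)))"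
    by (simp add: parts_def del: upt_Suc)
  ultimately have "I = (a, a + (b - a) / real (Suc (length ts)))" by simp
  then show ?thesis using assms unfolding leaf_intervals_Caret P by simp
qed

subsection \<open>The group\<close>

locale stein_params =
  fixes k :: nat and n :: "nat \<Rightarrow> nat"
  assumes k_gt_1: "k > 1"
    and n_ge_2: "j \<in> {1..k} \<Longrightarrow> n j \<ge> 2"
    and n1_dvd: "j \<in> {1..k} \<Longrightarrow> n 1 - 1 dvd n j - 1"
begin

section \<open>Diagrams as pairs of interval lists: composition and inversion\<close>

abbreviation caret_types :: "nat set" where
  "caret_types \<equiv> n ` {1..k}"

lemma zero_notin_caret_types: "0 \<notin> caret_types"
  using n_ge_2 by fastforce

lemma n1_ge_2: "n 1 \<ge> 2" and n1_arity: "n 1 \<in> caret_types"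
  using k_gt_1 n_ge_2[of 1] by auto

text \<open>Leaf intervals of these trees are nondegenerate, so the positivity conjuncts of
  \<open>aff\<close> hold automatically and the indexed condition becomes a relation of two
  lists.\<close>

lemma represents_iff:
  "represents k n D R x \<longleftrightarrow> ary_tree caret_types D \<and> ary_tree caret_types R \<and>
     list_all2 (aff x) (leaf_intervals 0 1 D) (leaf_intervals 0 1 R)"
proof -
  have "fst (leaf_intervals 0 1 T ! i) < snd (leaf_intervals 0 1 T ! i)"
    if "ary_tree caret_types T" "i < leaves T" for T i
    using chain_nondeg[OF chain_leaf_intervals[OF that(1) zero_notin_caret_types zero_less_one]] that(2)
    by (metis length_leaf_intervals nth_mem)
  then show ?thesis
    by (auto simp: represents_def list_all2_conv_all_nth length_leaf_intervals aff_def
        Let_def case_prod_beta)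
qed

lemma represents_chain:
  assumes "represents k n D R x"
  shows "chain 0 (leaf_intervals 0 1 D) 1" "chain 0 (leaf_intervals 0 1 R) 1"
    "list_all2 (aff x) (leaf_intervals 0 1 D) (leaf_intervals 0 1 R)"
  using assms chain_leaf_intervals[OF _ zero_notin_caret_types]
  unfolding represents_iff by auto

lemma represents_compose:
  assumes g: "represents k n Dg Rg g"
    and b: "\<And>m. m \<in> caret_types \<Longrightarrow> m \<le> b" "b \<ge> 1"
  shows "\<exists>r. \<forall>D R x y. represents k n D R x \<longrightarrow> (\<forall>t\<in>{0..1}. y t = g (x t)) \<longrightarrow>
           (\<exists>D' R'. represents k n D' R' y \<and> leaves D' \<le> b ^ r * leaves D)"
proof -
  have "(par caret_types)\<^sup>*\<^sup>* [(0, 1)] (leaf_intervals 0 1 Dg)"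
    using g par_leaf_intervals unfolding represents_iff by blast
  \<comment> \<open>\<open>r\<close> is fixed before \<open>x\<close> is given, so the factor
    \<open>b ^ r\<close> depends on \<open>g\<close> only.\<close>
  then obtain r where r: "(par caret_types ^^ r) [(0, 1)] (leaf_intervals 0 1 Dg)"
    by (auto simp: rtranclp_power)
  have "\<exists>D' R'. represents k n D' R' y \<and> leaves D' \<le> b ^ r * leaves D"
    if x: "represents k n D R x" and y: "\<forall>t\<in>{0..1}. y t = g (x t)" for D R x y
  proof -
    have "(par caret_types)\<^sup>*\<^sup>* [(0, 1)] (leaf_intervals 0 1 R)"
      using x par_leaf_intervals unfolding represents_iff by blast
    \<comment> \<open>\<open>M\<close> refines the domain list of \<open>g\<close> and the range
      list of \<open>x\<close>, the latter in \<open>r\<close> steps. Pushing \<open>M\<close>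
      through \<open>g\<close> and pulling it back through \<open>x\<close> gives a diagram of
      \<open>y\<close>.\<close>
    from par_tile[OF zero_notin_caret_types r this] obtain M where
      M: "(par caret_types)\<^sup>*\<^sup>* (leaf_intervals 0 1 Dg) M" "(par caret_types ^^ r) (leaf_intervals 0 1 R) M"
      by blast
    have M': "(par caret_types)\<^sup>*\<^sup>* (leaf_intervals 0 1 R) M"
      using M(2) by (auto simp: rtranclp_power)
    obtain L where L: "(par caret_types)\<^sup>*\<^sup>* (leaf_intervals 0 1 Rg) L" "list_all2 (aff g) M L"
      using par_rtranclp_aff_left[OF M(1) represents_chain(3)[OF g] zero_notin_caret_types] by blast
    obtain K where K: "(par caret_types)\<^sup>*\<^sup>* (leaf_intervals 0 1 D) K" "list_all2 (aff x) K M"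
      using par_rtranclp_aff_right[OF M' represents_chain(3)[OF x] zero_notin_caret_types] by blast
    obtain D' where D': "ary_tree caret_types D'" "K = leaf_intervals 0 1 D'"
      using par_rtranclp_leaf_intervals_tree[OF K(1)] x unfolding represents_iff by blast
    obtain R' where R': "ary_tree caret_types R'" "L = leaf_intervals 0 1 R'"
      using par_rtranclp_leaf_intervals_tree[OF L(1)] g unfolding represents_iff by blast
    have "aff y (K ! i) (L ! i)" if "i < length K" for i
    proof (rule aff_compose)
      show "aff x (K ! i) (M ! i)" "aff g (M ! i) (L ! i)"
        using K(2) L(2) that by (auto simp: list_all2_conv_all_nth)
      have "0 \<le> fst (K ! i) \<and> snd (K ! i) \<le> 1"
        using chain_bounds[OF chain_leaf_intervals[OF D'(1) zero_notin_caret_types zero_less_one]] that D'(2)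
        by (metis nth_mem)
      then show "\<And>t. t \<in> {fst (K ! i)..snd (K ! i)} \<Longrightarrow> y t = g (x t)" using y by auto
    qed
    then have "represents k n D' R' y"
      using K(2) L(2) D' R' by (simp add: represents_iff list_all2_conv_all_nth)
    moreover have "leaves D' = length M"
      using K(2) D'(2) by (metis length_leaf_intervals list_all2_lengthD)
    moreover have "length M \<le> b ^ r * leaves D"
      using length_relpowp_par[OF b M(2)] represents_chain(3)[OF x]
      by (metis length_leaf_intervals list_all2_lengthD)
    ultimately show ?thesis by metis
  qed
  then show ?thesis by blast
qed

lemma represents_inverse:
  assumes "represents k n D R x" "\<And>t. t \<in> {0..1} \<Longrightarrow> y (x t) = t"
  shows "represents k n R D y"
proof -
  have "list_all2 (aff y) (leaf_intervals 0 1 R) (leaf_intervals 0 1 D)"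
    unfolding list_all2_conv_all_nth
  proof (intro conjI allI impI)
    note l = represents_chain(3)[OF assms(1)]
    show len: "length (leaf_intervals 0 1 R) = length (leaf_intervals 0 1 D)"
      using l by (simp add: list_all2_lengthD)
    fix i assume i: "i < length (leaf_intervals 0 1 R)"
    then have "0 \<le> fst (leaf_intervals 0 1 D ! i) \<and> snd (leaf_intervals 0 1 D ! i) \<le> 1"
      using chain_bounds[OF represents_chain(1)[OF assms(1)]] len by (metis nth_mem)
    moreover have "aff x (leaf_intervals 0 1 D ! i) (leaf_intervals 0 1 R ! i)"
      using l i len by (simp add: list_all2_nthD2)
    ultimately show "aff y (leaf_intervals 0 1 R ! i) (leaf_intervals 0 1 D ! i)"
      by (elim aff_inverse) (simp add: assms(2))
  qed
  then show ?thesis using assms(1) unfolding represents_iff by blast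
qed

section \<open>The breakpoint ring, the slope group and the intervals of trees\<close>

lemma fractions_ring_add:
  assumes "u \<in> fractions_ring k n" "v \<in> fractions_ring k n"
  shows "u + v \<in> fractions_ring k n"
proof -
  define P where "P = (\<Prod>j\<in>{1..k}. n j)"
  have "P > 0" using n_ge_2 unfolding P_def by (intro prod_pos) fastforce
  from assms obtain a b :: int and e f where "u = of_int a / real P ^ e" "v = of_int b / real P ^ f"
    unfolding fractions_ring_def P_def by blast
  then have "u + v = of_int (a * int P ^ f + b * int P ^ e) / real P ^ (e + f)"
    using \<open>P > 0\<close> by (simp add: add_frac_eq power_add)
  then show ?thesis unfolding fractions_ring_def P_def by blast
qed

lemma fractions_ring_mult:
  assumes "u \<in> fractions_ring k n" "v \<in> fractions_ring k n"
  shows "u * v \<in> fractions_ring k n"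
proof -
  define P where "P = (\<Prod>j\<in>{1..k}. n j)"
  from assms obtain a b :: int and e f where "u = of_int a / real P ^ e" "v = of_int b / real P ^ f"
    unfolding fractions_ring_def P_def by blast
  then have "u * v = of_int (a * b) / real P ^ (e + f)"
    by (simp add: field_simps power_add)
  then show ?thesis unfolding fractions_ring_def P_def by blast
qed

lemma fractions_ring_of_nat: "real i \<in> fractions_ring k n"
proof -
  have "real i = of_int (int i) / real (\<Prod>j\<in>{1..k}. n j) ^ 0" by simp
  then show ?thesis unfolding fractions_ring_def by blast
qed

lemma fractions_ring_inverse_arity:
  assumes "m \<in> caret_types"
  shows "1 / real m \<in> fractions_ring k n"
proof -
  obtain j where j: "j \<in> {1..k}" "m = n j" using assms by blast
  have "(\<Prod>j\<in>{1..k}. n j) = n j * (\<Prod>i\<in>{1..k} - {j}. n i)"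
    using j by (intro prod.remove) auto
  moreover have "(\<Prod>i\<in>{1..k} - {j}. n i) > 0" using n_ge_2 by (intro prod_pos) fastforce
  moreover have "n j > 0" using n_ge_2[OF j(1)] by simp
  \<comment> \<open>The numerator is the product of the other arities.\<close>
  ultimately have "1 / real m = of_int (int (\<Prod>i\<in>{1..k} - {j}. n i)) / real (\<Prod>j\<in>{1..k}. n j) ^ 1"
    using j by (simp add: field_simps del: of_nat_prod)
  then show ?thesis unfolding fractions_ring_def by blast
qed

lemma slope_group_mult:
  assumes "u \<in> slope_group k n" "v \<in> slope_group k n"
  shows "u * v \<in> slope_group k n"
proof -
  from assms obtain e f where "u = (\<Prod>j\<in>{1..k}. real (n j) powi e j)"
    "v = (\<Prod>j\<in>{1..k}. real (n j) powi f j)" unfolding slope_group_def by blast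
  then have "u * v = (\<Prod>j\<in>{1..k}. real (n j) powi (e j + f j))"
    using n_ge_2 by (simp add: prod.distrib[symmetric]) (intro prod.cong refl, force simp: power_int_add)
  then show ?thesis
    unfolding slope_group_def by (auto intro!: exI[of _ "\<lambda>j. e j + f j"])
qed

lemma slope_group_inverse:
  assumes "u \<in> slope_group k n"
  shows "inverse u \<in> slope_group k n"
proof -
  from assms obtain e where "u = (\<Prod>j\<in>{1..k}. real (n j) powi e j)"
    unfolding slope_group_def by blast
  then have "inverse u = (\<Prod>j\<in>{1..k}. real (n j) powi (- e j))"
    by (simp add: prod_inversef[symmetric] power_int_minus o_def)
  then show ?thesis
    unfolding slope_group_def by (auto intro!: exI[of _ "\<lambda>j. - e j"])
qed

lemma slope_group_one: "1 \<in> slope_group k n"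
  unfolding slope_group_def by (auto intro!: exI[of _ "\<lambda>_. 0"])

lemma slope_group_arity:
  assumes "m \<in> caret_types"
  shows "real m \<in> slope_group k n"
proof -
  obtain j where j: "j \<in> {1..k}" "m = n j" using assms by blast
  have "(\<Prod>i\<in>{1..k}. real (n i) powi (if i = j then 1 else 0)) = (\<Prod>i\<in>{1..k}. if i = j then real (n i) else 1)"
    by (intro prod.cong) auto
  also have "\<dots> = real m" using j by simp
  finally have "real m = (\<Prod>i\<in>{1..k}. real (n i) powi (if i = j then 1 else 0))" by (rule sym)
  then show ?thesis unfolding slope_group_def mem_Collect_eq by (intro exI conjI TrueI)
qed

text \<open>Properties that every cut inherits, starting from the unit interval. Ring and slope
  group serve \<open>pl_map\<close>; a length that is the reciprocal of an integer serves the
  denominator argument in \<open>leaves_ge_of_slope\<close>.\<close>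

definition standard_interval :: "real \<times> real \<Rightarrow> bool" where
  "standard_interval I \<longleftrightarrow> fst I \<in> fractions_ring k n \<and> snd I - fst I \<in> fractions_ring k n \<and>
     snd I - fst I \<in> slope_group k n \<and> (\<exists>q::nat. q > 0 \<and> snd I - fst I = 1 / real q)"

lemma standard_interval_parts:
  assumes "standard_interval I" "m \<in> caret_types" "J \<in> set (parts m I)"
  shows "standard_interval J"
proof -
  have "m > 0" using assms(2) zero_notin_caret_types by (auto intro: gr0I)
  from assms(3) obtain i where "J = (fst I + real i * (snd I - fst I) / real m,
      fst I + real (Suc i) * (snd I - fst I) / real m)"
    by (auto simp: parts_def)
  then have J: "fst J = fst I + real i * ((snd I - fst I) * (1 / real m))"
    "snd J - fst J = (snd I - fst I) * (1 / real m)"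
    using \<open>m > 0\<close> by (simp_all add: field_simps)
  obtain q :: nat where q: "q > 0" "snd I - fst I = 1 / real q"
    using assms(1) by (auto simp: standard_interval_def)
  then have "snd J - fst J = 1 / real (q * m)" "q * m > 0" using J(2) \<open>m > 0\<close> by simp_all
  moreover have "1 / real m \<in> slope_group k n"
    using slope_group_inverse[OF slope_group_arity[OF assms(2)]] by (simp add: inverse_eq_divide)
  moreover have I: "fst I \<in> fractions_ring k n" "snd I - fst I \<in> fractions_ring k n"
    using assms(1) by (simp_all add: standard_interval_def)
  note len = fractions_ring_mult[OF I(2) fractions_ring_inverse_arity[OF assms(2)]]
  have "snd J - fst J \<in> fractions_ring k n"
    unfolding J(2) by (rule len)
  moreover have "fst J \<in> fractions_ring k n"
    unfolding J(1) by (rule fractions_ring_add[OF I(1) fractions_ring_mult[OF fractions_ring_of_nat len]])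
  ultimately show ?thesis
    using assms(1) slope_group_mult[of "snd I - fst I" "1 / real m"] J(2)
    unfolding standard_interval_def by (intro conjI exI[of _ "q * m"]) simp_all
qed

lemma standard_interval_par:
  "par caret_types K L \<Longrightarrow> \<forall>I\<in>set K. standard_interval I \<Longrightarrow> \<forall>I\<in>set L. standard_interval I"
proof (induction rule: par.induct)
  case (par_split m K L I)
  then have "\<forall>J\<in>set (parts m I). standard_interval J"
    using standard_interval_parts[of I m] by simp
  then show ?case using par_split by auto
qed auto

lemma standard_interval_leaf_intervals:
  assumes "ary_tree caret_types T" "I \<in> set (leaf_intervals 0 1 T)"
  shows "standard_interval I"
proof -
  have "\<forall>I\<in>set (leaf_intervals 0 1 T). standard_interval I"
    using par_leaf_intervals[OF assms(1), of 0 1]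
  proof (induction rule: rtranclp_induct)
    case base
    then show ?case
      using fractions_ring_of_nat[of 0] fractions_ring_of_nat[of 1] slope_group_one
      by (auto simp: standard_interval_def intro!: exI[of _ 1])
  next
    case (step K L)
    then show ?case using standard_interval_par by blast
  qed
  then show ?thesis using assms(2) by blast
qed

section \<open>Maps given by diagrams as group elements\<close>

lemma represents_homeo:
  assumes "represents k n D R x"
  shows "strict_mono_on {0..1} x" "x ` {0..1} = {0..1}" "continuous_on {0..1} x"
proof -
  note c = represents_chain[OF assms]
  obtain I K where K: "leaf_intervals 0 1 D = I # K"
    using c(1) by (cases "leaf_intervals 0 1 D") auto
  with c(3) obtain J L where L: "leaf_intervals 0 1 R = J # L" "aff x I J"
    by (auto simp: list_all2_Cons1)
  then have "x 0 = 0" using c(1,2) K by (auto simp: aff_def)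
  then show "strict_mono_on {0..1} x" "x ` {0..1} = {0..1}" "continuous_on {0..1} x"
    using chain_aff_homeo[OF c] by auto
qed

text \<open>The end points of the domain leaves form \<open>P\<close>. An interval avoiding them in
  its interior lies in one leaf, where the slope is a quotient of two leaf lengths.\<close>

lemma represents_pl_map:
  assumes "represents k n D R x"
  shows "pl_map k n x"
proof -
  let ?K = "leaf_intervals 0 1 D"
  let ?P = "fst ` set ?K \<union> snd ` set ?K"
  note c = represents_chain[OF assms]
  have ary: "ary_tree caret_types D" "ary_tree caret_types R" using assms by (auto simp: represents_iff)
  have P: "?P \<subseteq> fractions_ring k n \<inter> {0..1}"
  proof -
    have "fst I \<in> fractions_ring k n \<inter> {0..1} \<and> snd I \<in> fractions_ring k n \<inter> {0..1}"
      if "I \<in> set ?K" for I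
    proof -
      have "standard_interval I" using standard_interval_leaf_intervals[OF ary(1) that] .
      then have "fst I \<in> fractions_ring k n" "fst I + (snd I - fst I) \<in> fractions_ring k n"
        unfolding standard_interval_def by (blast intro: fractions_ring_add)+
      then show ?thesis using chain_bounds[OF c(1) that] chain_nondeg[OF c(1) that] by auto
    qed
    then show ?thesis by blast
  qed
  have H: "\<exists>s\<in>slope_group k n. \<forall>t\<in>{a..b}. x t = x a + s * (t - a)"
    if ab: "0 \<le> a" "a < b" "b \<le> 1" "{a<..<b} \<inter> ?P = {}" for a b
  proof -
    obtain I where I: "I \<in> set ?K" "fst I \<le> a" "b \<le> snd I"
      using chain_no_endpoint[OF c(1) ab] by blast
    then obtain i where i: "i < length ?K" "I = ?K ! i" by (auto simp: in_set_conv_nth)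
    define J where "J = leaf_intervals 0 1 R ! i"
    have J: "aff x I J" "J \<in> set (leaf_intervals 0 1 R)"
      using c(3) i by (auto simp: list_all2_conv_all_nth J_def)
    have "standard_interval I" "standard_interval J"
      using standard_interval_leaf_intervals ary I(1) J(2) by blast+
    then have "(snd J - fst J) * inverse (snd I - fst I) \<in> slope_group k n"
      unfolding standard_interval_def using slope_group_mult slope_group_inverse by blast
    then have "(snd J - fst J) / (snd I - fst I) \<in> slope_group k n" by (simp add: divide_inverse)
    moreover have "\<forall>t\<in>{a..b}. x t = x a + (snd J - fst J) / (snd I - fst I) * (t - a)"
      using I ab by (intro ballI aff_slope[OF J(1)]) auto
    ultimately show ?thesis by (rule bexI[rotated])
  qed
  show ?thesis unfolding pl_map_def
  proof (intro exI[of _ ?P] conjI allI impI)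
    show "finite ?P" by simp
    show "?P \<subseteq> fractions_ring k n \<inter> {0..1}" by (rule P)
  qed (elim conjE, rule H)
qed

text \<open>A subset of the carrier that is closed under products and inverses and contains the
  generators, so every word product has a diagram.\<close>

definition diagram_elts :: "(real \<Rightarrow> real) set" where
  "diagram_elts = {x \<in> extensional {0..1}. \<exists>D R. represents k n D R x}"

lemma represents_Bij:
  assumes "represents k n D R x" "x \<in> extensional {0..1}"
  shows "x \<in> Bij {0..1}"
  using represents_homeo[OF assms(1)] assms(2)
  by (auto simp: Bij_def bij_betw_def intro: strict_mono_on_imp_inj_on)

lemma carrier_TS:
  "carrier (TS k n) = {f \<in> Bij {0..1}. (\<exists>g. homeomorphism {0..1} {0..1} f g) \<and>
                    strict_mono_on {0..1} f \<and> pl_map k n f}"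
  by (simp add: TS_def)

lemma diagram_elts_carrier: "diagram_elts \<subseteq> carrier (TS k n)"
proof
  fix x assume "x \<in> diagram_elts"
  then obtain D R where x: "x \<in> extensional {0..1}" "represents k n D R x"
    by (auto simp: diagram_elts_def)
  have "inj_on x {0..1}" using represents_homeo[OF x(2)] by (auto intro: strict_mono_on_imp_inj_on)
  then have "\<exists>g. homeomorphism {0..1} {0..1} x g"
    using homeomorphism_compact[OF compact_Icc represents_homeo(3,2)[OF x(2)]] by blast
  then show "x \<in> carrier (TS k n)"
    unfolding carrier_TS
    by (intro CollectI conjI represents_Bij[OF x(2,1)] represents_homeo(1)[OF x(2)]
        represents_pl_map[OF x(2)])
qed

lemma carrier_Bij: "x \<in> carrier (TS k n) \<Longrightarrow> x \<in> Bij {0..1}"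
  by (simp add: TS_def)

lemma mult_TS: "g \<in> Bij {0..1} \<Longrightarrow> f \<in> Bij {0..1} \<Longrightarrow> g \<otimes>\<^bsub>TS k n\<^esub> f = compose {0..1} g f"
  by (simp add: TS_def BijGroup_def)

lemma one_TS: "\<one>\<^bsub>TS k n\<^esub> = (\<lambda>t\<in>{0..1}. t)"
  by (simp add: TS_def BijGroup_def)

lemma one_represents: "represents k n Leaf Leaf \<one>\<^bsub>TS k n\<^esub>"
  by (simp add: represents_iff one_TS aff_def)

lemma diagram_elts_Bij: "diagram_elts \<subseteq> Bij {0..1}"
  using diagram_elts_carrier carrier_Bij by blast

lemma diagram_elts_inv:
  assumes "x \<in> diagram_elts"
  shows "inv\<^bsub>TS k n\<^esub> x \<in> diagram_elts" "\<And>t. t \<in> {0..1} \<Longrightarrow> (inv\<^bsub>TS k n\<^esub> x) (x t) = t"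
proof -
  define y where "y = restrict (inv_into {0..1} x) {0..1}"
  obtain D R where x: "represents k n D R x" using assms by (auto simp: diagram_elts_def)
  have inj: "inj_on x {0..1}" and im: "x ` {0..1} = {0..1}"
    using represents_homeo[OF x] by (auto intro: strict_mono_on_imp_inj_on)
  have yx: "y (x t) = t" if "t \<in> {0..1}" for t
  proof -
    have "x t \<in> {0..1}" using that im by blast
    then show ?thesis using inv_into_f_f[OF inj that] by (simp add: y_def)
  qed
  have xy: "x (y t) = t" "y t \<in> {0..1}" if "t \<in> {0..1}" for t
  proof -
    have "t \<in> x ` {0..1}" using that im by blast
    then show "x (y t) = t" "y t \<in> {0..1}"
      using that f_inv_into_f[of t x "{0..1}"] inv_into_into[of t x "{0..1}"] by (auto simp: y_def)
  qed
  have "represents k n R D y" using represents_inverse[OF x] yx by blast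
  then have y: "y \<in> diagram_elts" by (auto simp: diagram_elts_def y_def)
  have B: "x \<in> Bij {0..1}" "y \<in> Bij {0..1}" using assms y diagram_elts_Bij by auto
  have "inv\<^bsub>TS k n\<^esub> x = y"
    \<comment> \<open>\<open>m_inv\<close> is a description over the carrier, so uniqueness is
      checked directly: a left inverse \<open>y'\<close> of \<open>x\<close> satisfies
      \<open>y' t = y' (x (y t)) = y t\<close>.\<close>
    unfolding m_inv_def
  proof (rule the_equality)
    show "y \<in> carrier (TS k n) \<and> x \<otimes>\<^bsub>TS k n\<^esub> y = \<one>\<^bsub>TS k n\<^esub> \<and> y \<otimes>\<^bsub>TS k n\<^esub> x = \<one>\<^bsub>TS k n\<^esub>"
      using y diagram_elts_carrier xy yx B by (auto simp: mult_TS one_TS compose_def restrict_def)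
    fix y' assume "y' \<in> carrier (TS k n) \<and> x \<otimes>\<^bsub>TS k n\<^esub> y' = \<one>\<^bsub>TS k n\<^esub> \<and> y' \<otimes>\<^bsub>TS k n\<^esub> x = \<one>\<^bsub>TS k n\<^esub>"
    then have y': "y' \<in> Bij {0..1}" "compose {0..1} y' x = (\<lambda>t\<in>{0..1}. t)"
      using carrier_Bij B by (auto simp: mult_TS one_TS)
    show "y' = y"
    proof (rule extensionalityI[of _ "{0..1}"])
      show "y' \<in> extensional {0..1}" "y \<in> extensional {0..1}"
        using y'(1) by (auto simp: Bij_def y_def)
      fix t :: real assume t: "t \<in> {0..1}"
      have "y' (x (y t)) = y t"
        using fun_cong[OF y'(2), of "y t"] xy[OF t] by (simp add: compose_def)
      then show "y' t = y t" using xy[OF t] by simp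
    qed
  qed
  then show "inv\<^bsub>TS k n\<^esub> x \<in> diagram_elts" "\<And>t. t \<in> {0..1} \<Longrightarrow> (inv\<^bsub>TS k n\<^esub> x) (x t) = t"
    using y yx by auto
qed

lemma diagram_elts_mult:
  assumes "g \<in> diagram_elts" "x \<in> diagram_elts"
  shows "g \<otimes>\<^bsub>TS k n\<^esub> x \<in> diagram_elts"
    "t \<in> {0..1} \<Longrightarrow> (g \<otimes>\<^bsub>TS k n\<^esub> x) t = g (x t)"
proof -
  have eq: "g \<otimes>\<^bsub>TS k n\<^esub> x = compose {0..1} g x"
    using assms diagram_elts_Bij by (intro mult_TS) auto
  then show *: "(g \<otimes>\<^bsub>TS k n\<^esub> x) t = g (x t)" if "t \<in> {0..1}" for t
    using that by (simp add: compose_def)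
  have b: "m \<le> Max caret_types" if "m \<in> caret_types" for m using that by simp
  moreover have "Max caret_types \<ge> 1" using b[OF n1_arity] n1_ge_2 by linarith
  moreover obtain Dg Rg D R where "represents k n Dg Rg g" "represents k n D R x"
    using assms by (auto simp: diagram_elts_def)
  ultimately obtain D' R' where "represents k n D' R' (g \<otimes>\<^bsub>TS k n\<^esub> x)"
    using represents_compose[of Dg Rg g "Max caret_types"] * by metis
  moreover have "g \<otimes>\<^bsub>TS k n\<^esub> x \<in> extensional {0..1}" by (simp add: eq compose_def)
  ultimately show "g \<otimes>\<^bsub>TS k n\<^esub> x \<in> diagram_elts" by (auto simp: diagram_elts_def)
qed

section \<open>Word products and the growth of diagrams\<close>

abbreviation word_product :: "(real \<Rightarrow> real) list \<Rightarrow> real \<Rightarrow> real" where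
  "word_product ws \<equiv> foldr (mult (TS k n)) ws \<one>\<^bsub>TS k n\<^esub>"

text \<open>Turns a word into iterated application of its letters, the last letter first, so that
  values can be computed pointwise.\<close>

lemma word_product_diagram_elts:
  assumes "set ws \<subseteq> diagram_elts"
  shows "word_product ws \<in> diagram_elts"
    "t \<in> {0..1} \<Longrightarrow> word_product ws t = foldr (\<lambda>g. g) ws t"
proof -
  have "word_product ws \<in> diagram_elts \<and>
        (\<forall>t\<in>{0..1}. word_product ws t = foldr (\<lambda>g. g) ws t)"
    using assms
  proof (induction ws)
    case Nil
    have "\<one>\<^bsub>TS k n\<^esub> \<in> diagram_elts"
      using one_represents unfolding diagram_elts_def by (auto simp: one_TS)
    moreover have "\<forall>t\<in>{0..1}. \<one>\<^bsub>TS k n\<^esub> t = t" by (simp add: one_TS)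
    ultimately show ?case by simp
  next
    case (Cons g ws)
    then show ?case using diagram_elts_mult[of g "word_product ws"] by simp
  qed
  then show "word_product ws \<in> diagram_elts"
    "t \<in> {0..1} \<Longrightarrow> word_product ws t = foldr (\<lambda>g. g) ws t" by auto
qed

text \<open>By \<open>represents_compose\<close> a letter \<open>g\<close> multiplies the number of
  leaves by at most \<open>b ^ r g\<close>, and these factors have a common bound on a finite
  set.\<close>

lemma min_leaves_word_product:
  assumes "finite G" "G \<subseteq> diagram_elts"
  shows "\<exists>B>1. \<forall>ws. set ws \<subseteq> G \<longrightarrow> min_leaves k n (word_product ws) \<le> B ^ length ws"
proof -
  define b where "b = Max caret_types"
  have b: "m \<le> b" if "m \<in> caret_types" for m using that by (simp add: b_def)
  have "b > 1" using b[OF n1_arity] n1_ge_2 by linarith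
  have "\<exists>r. \<forall>D R x y. represents k n D R x \<longrightarrow> (\<forall>t\<in>{0..1}. y t = g (x t)) \<longrightarrow>
           (\<exists>D' R'. represents k n D' R' y \<and> leaves D' \<le> b ^ r * leaves D)" if "g \<in> G" for g
    using that assms(2) represents_compose[OF _ b] \<open>b > 1\<close> by (auto simp: diagram_elts_def)
  then obtain r where r: "\<And>g D R x y. g \<in> G \<Longrightarrow> represents k n D R x \<Longrightarrow> (\<forall>t\<in>{0..1}. y t = g (x t)) \<Longrightarrow>
           \<exists>D' R'. represents k n D' R' y \<and> leaves D' \<le> b ^ r g * leaves D"
    by metis
  \<comment> \<open>The sum dominates every \<open>r g\<close>, and \<open>Suc\<close> keeps
    \<open>B > 1\<close> even if all \<open>r g\<close> vanish.\<close>
  define B where "B = b ^ Suc (sum r G)"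
  have "B > 1" using \<open>b > 1\<close> unfolding B_def by (intro one_less_power) auto
  have rB: "b ^ r g \<le> B" if "g \<in> G" for g
    using member_le_sum[OF that, of r] assms(1) \<open>b > 1\<close> unfolding B_def
    by (intro power_increasing) auto
  have ex: "\<exists>D R. represents k n D R (word_product ws) \<and> leaves D \<le> B ^ length ws"
    if "set ws \<subseteq> G" for ws
    using that
  proof (induction ws)
    case Nil
    then show ?case using one_represents by fastforce
  next
    case (Cons g ws)
    then obtain D R where DR: "represents k n D R (word_product ws)" "leaves D \<le> B ^ length ws"
      by auto
    have g: "g \<in> G" "g \<in> diagram_elts" "set ws \<subseteq> diagram_elts" using Cons.prems assms(2) by auto
    have "\<forall>t\<in>{0..1}. word_product (g # ws) t = g (word_product ws t)"
      using diagram_elts_mult(2)[OF g(2) word_product_diagram_elts(1)[OF g(3)]] by simp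
    then obtain D' R' where "represents k n D' R' (word_product (g # ws))"
      "leaves D' \<le> b ^ r g * leaves D" using r[OF g(1) DR(1)] by blast
    moreover have "b ^ r g * leaves D \<le> B * B ^ length ws"
      using rB[OF g(1)] DR(2) by (intro mult_mono) auto
    ultimately show ?case by (metis le_trans length_Cons power_Suc)
  qed
  have "min_leaves k n (word_product ws) \<le> B ^ length ws" if "set ws \<subseteq> G" for ws
  proof -
    from ex[OF that] obtain D R
      where "represents k n D R (word_product ws)" "leaves D \<le> B ^ length ws"
      by blast
    moreover from this(1) have "min_leaves k n (word_product ws) \<le> leaves D"
      unfolding min_leaves_def by (intro Least_le) blast
    ultimately show ?thesis by simp
  qed
  then show ?thesis using \<open>B > 1\<close> by blast
qed


section \<open>The generators and their diagrams\<close>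

text \<open>A caret of type n_j replaces one leaf by n_j leaves and so adds a multiple of n_1 - 1,
  by \<open>n1_dvd\<close>. Hence some right n_1-string has as many leaves as
  \<open>T\<close>.\<close>

lemma leaves_mod:
  assumes "ary_tree caret_types T"
  shows "\<exists>d. leaves T = 1 + d * (n 1 - 1)"
  using assms
proof (induction T)
  case Leaf
  then show ?case by (intro exI[of _ 0]) simp
next
  case (Caret ts)
  obtain j where j: "j \<in> {1..k}" "length ts = n j" using Caret.prems by auto
  obtain e where e: "n j - 1 = (n 1 - 1) * e" using n1_dvd[OF j(1)] by (elim dvdE)
  obtain d where "sum_list (map leaves ts) = length ts + d * (n 1 - 1)"
    using sum_list_leaves_mod[of ts "n 1 - 1"] Caret by auto
  moreover have "length ts = 1 + (n 1 - 1) * e" using e j n_ge_2[OF j(1)] by linarith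
  ultimately have "leaves (Caret ts) = 1 + (e + d) * (n 1 - 1)"
    by (simp only: leaves.simps add_mult_distrib mult.commute[of _ e] add.assoc)
  then show ?case by blast
qed

lemma diagram_exists:
  assumes "ary_tree caret_types D" "ary_tree caret_types R" "leaves D = leaves R"
  shows "\<exists>x\<in>diagram_elts. represents k n D R x"
proof -
  note c = chain_leaf_intervals[OF _ zero_notin_caret_types zero_less_one]
  obtain x where x: "list_all2 (aff x) (leaf_intervals 0 1 D) (leaf_intervals 0 1 R)"
    using chain_aff_exists[OF c[OF assms(1)] c[OF assms(2)]] assms(3) length_leaf_intervals by metis
  then have Rx: "represents k n D R x" using assms by (simp add: represents_iff)
  \<comment> \<open>Restriction makes the map extensional, as group elements are.\<close>
  have "list_all2 (aff (restrict x {0..1})) (leaf_intervals 0 1 D) (leaf_intervals 0 1 R)"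
  proof (rule list.rel_mono_strong[OF x])
    fix I J assume "I \<in> set (leaf_intervals 0 1 D)" "aff x I J"
    moreover from this have "0 \<le> fst I \<and> snd I \<le> 1"
      using chain_bounds[OF represents_chain(1)[OF Rx]] by blast
    ultimately show "aff (restrict x {0..1}) I J" by (auto simp: aff_def)
  qed
  then have "represents k n D R (restrict x {0..1})" using assms by (simp add: represents_iff)
  then show ?thesis unfolding diagram_elts_def by (intro bexI CollectI conjI exI) auto
qed

lemma represents_unique:
  assumes "represents k n D R x" "represents k n D R y" "t \<in> {0..1}"
  shows "x t = y t"
proof -
  have cover: "\<exists>I\<in>set K. t \<in> {fst I..snd I}" if "chain a K b" "a < b" "t \<in> {a..b}" for K a b
    using that
  proof (induction K arbitrary: a)
    case (Cons I K)
    then show ?case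
      by (cases "t \<le> snd I"; cases "snd I < b") (auto dest: chain_le)
  qed simp
  obtain I where "I \<in> set (leaf_intervals 0 1 D)" "t \<in> {fst I..snd I}"
    using cover[OF represents_chain(1)[OF assms(1)] zero_less_one assms(3)] by blast
  then obtain i where i: "i < length (leaf_intervals 0 1 D)" "t \<in> {fst (leaf_intervals 0 1 D ! i)..snd (leaf_intervals 0 1 D ! i)}"
    by (auto simp: in_set_conv_nth)
  have "aff x (leaf_intervals 0 1 D ! i) (leaf_intervals 0 1 R ! i)"
    "aff y (leaf_intervals 0 1 D ! i) (leaf_intervals 0 1 R ! i)"
    using represents_chain(3)[OF assms(1)] represents_chain(3)[OF assms(2)] i(1)
    by (simp_all add: list_all2_nthD)
  then show ?thesis using i(2) by (simp add: aff_def)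
qed

text \<open>Justifies the description in \<open>string_elt\<close>: \<open>leaves_mod\<close>
  provides the string, its length is determined by the leaf count because n_1 - 1 > 0, and a diagram
  determines the map on the unit interval.\<close>

lemma string_elt:
  assumes "ary_tree caret_types R"
  shows "string_elt k n R \<in> diagram_elts"
    "\<exists>d. represents k n (right_string (n 1) d) R (string_elt k n R)"
proof -
  obtain d where d: "leaves R = 1 + d * (n 1 - 1)" using leaves_mod[OF assms] by blast
  have pos: "n 1 > 0" "n 1 - 1 > 0" using n1_ge_2 by auto
  obtain x where x: "x \<in> diagram_elts" "represents k n (right_string (n 1) d) R x"
    using diagram_exists[OF ary_tree_right_string[OF n1_arity pos(1)] assms, of d] d
      leaves_right_string[OF pos(1), of d] by auto
  have "string_elt k n R = x"
    unfolding string_elt_def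
  proof (rule the_equality)
    show "x \<in> carrier (TS k n) \<and> (\<exists>d. represents k n (right_string (n 1) d) R x)"
      using x diagram_elts_carrier by blast
    fix y assume "y \<in> carrier (TS k n) \<and> (\<exists>d. represents k n (right_string (n 1) d) R y)"
    then obtain d' where y: "y \<in> carrier (TS k n)" "represents k n (right_string (n 1) d') R y" by blast
    from y(2) have "leaves (right_string (n 1) d') = leaves R"
      by (simp add: represents_def)
    then have "d' = d" using leaves_right_string[OF pos(1)] d pos(2) by simp
    show "y = x"
    proof (rule extensionalityI[of _ "{0..1}"])
      show "y \<in> extensional {0..1}" "x \<in> extensional {0..1}"
        using carrier_Bij[OF y(1)] x(1) by (auto simp: Bij_def diagram_elts_def)
      show "y t = x t" if "t \<in> {0..1}" for t
        using represents_unique[OF _ x(2) that] y(2) \<open>d' = d\<close> by blast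
    qed
  qed
  then show "string_elt k n R \<in> diagram_elts"
    "\<exists>d. represents k n (right_string (n 1) d) R (string_elt k n R)" using x by auto
qed

lemma ary_tree_n1_string: "ary_tree caret_types (right_string (n 1) d)"
  using n1_ge_2 by (intro ary_tree_right_string n1_arity) simp

lemma y_gen_diagram_elts: "j \<in> {1..k} \<Longrightarrow> y_gen k n j i \<in> diagram_elts"
  unfolding y_gen_def by (rule string_elt(1)[OF ary_tree_attach(1)[OF imageI ary_tree_n1_string]])

lemma z_gen_diagram_elts: "j \<in> {1..k} \<Longrightarrow> z_gen k n j i \<in> diagram_elts"
  unfolding z_gen_def by (rule string_elt(1)[OF ary_tree_attach(1)[OF imageI ary_tree_n1_string]])

section \<open>Word length and the logarithmic lower bound\<close>

definition signed_gens :: "(real \<Rightarrow> real) set" where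
  "signed_gens = std_gens k n \<union> m_inv (TS k n) ` std_gens k n"

lemma finite_signed_gens: "finite signed_gens"
proof -
  have "std_gens k n = (\<Union>j\<in>{2..k}. y_gen k n j ` {..<n j}) \<union> (\<Union>j\<in>{1..k}. z_gen k n j ` {..<n j})"
    unfolding std_gens_def by blast
  then have "finite (std_gens k n)" by simp
  then show ?thesis unfolding signed_gens_def by simp
qed

lemma signed_gens_diagram_elts: "signed_gens \<subseteq> diagram_elts"
proof -
  have "std_gens k n \<subseteq> diagram_elts"
    using y_gen_diagram_elts z_gen_diagram_elts unfolding std_gens_def by auto
  then show ?thesis using diagram_elts_inv(1) unfolding signed_gens_def by blast
qed

lemma word_length_le:
  assumes "set ws \<subseteq> signed_gens"
  shows "word_length (TS k n) (std_gens k n) (word_product ws) \<le> enat (length ws)"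
  unfolding word_length_def using assms by (intro INF_lower) (simp add: signed_gens_def)

lemma word_length_attained:
  assumes "word_length (TS k n) (std_gens k n) x \<noteq> \<infinity>"
  shows "\<exists>ws. set ws \<subseteq> signed_gens \<and> word_product ws = x \<and>
    word_length (TS k n) (std_gens k n) x = enat (length ws)"
proof -
  let ?W = "{ws. set ws \<subseteq> signed_gens \<and> word_product ws = x}"
  let ?E = "(\<lambda>ws. enat (length ws)) ` ?W"
  have eq: "word_length (TS k n) (std_gens k n) x = Inf ?E"
    by (simp add: word_length_def signed_gens_def)
  \<comment> \<open>The extended naturals are well-ordered, so the infimum of a nonempty set is a
    minimum.\<close>
  have attained: "Inf E \<in> E" if "E \<noteq> {}" for E :: "enat set"
    using that by (auto simp: Inf_enat_def intro: LeastI)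
  have "?E \<noteq> {}"
  proof
    assume "?E = {}"
    then have "Inf ?E = \<infinity>" by (simp only: Inf_enat_def simp_thms if_True)
    then show False using assms eq by simp
  qed
  then have "Inf ?E \<in> ?E" by (rule attained)
  then show ?thesis unfolding eq by auto
qed

text \<open>Infinite word length makes the bound trivial; otherwise a shortest word exists, and
  logarithms are taken in \<open>min_leaves_word_product\<close>.\<close>

lemma word_length_ge_log_min_leaves:
  "\<exists>B::nat. B > 1 \<and> (\<forall>x. ereal (log (real B) (real (min_leaves k n x)))
      \<le> ereal_of_enat (word_length (TS k n) (std_gens k n) x))"
proof -
  obtain B where B: "B > 1"
    "\<And>ws. set ws \<subseteq> signed_gens \<Longrightarrow> min_leaves k n (word_product ws) \<le> B ^ length ws"
    using min_leaves_word_product[OF finite_signed_gens signed_gens_diagram_elts] by blast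
  have "ereal (log (real B) (real (min_leaves k n x)))
      \<le> ereal_of_enat (word_length (TS k n) (std_gens k n) x)" for x
  proof (cases "word_length (TS k n) (std_gens k n) x = \<infinity>")
    case False
    then obtain ws where ws: "set ws \<subseteq> signed_gens" "word_product ws = x"
      "word_length (TS k n) (std_gens k n) x = enat (length ws)"
      using word_length_attained by blast
    have le: "real (min_leaves k n x) \<le> real B ^ length ws"
      using B(2)[OF ws(1)] unfolding ws(2) by (metis of_nat_le_iff of_nat_power)
    have "log (real B) (real (min_leaves k n x)) \<le> real (length ws)"
    \<comment> \<open>If the minimum is 0, the convention \<open>ln 0 = 0\<close> makes the
      left-hand side 0.\<close>
    proof (cases "min_leaves k n x = 0")
      case True
      then show ?thesis by (simp add: log_def)
    next
      case False
      then show ?thesis using le B(1)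
        by (subst log_le_iff) (auto simp: powr_realpow)
    qed
    then show ?thesis by (simp add: ws(3))
  qed simp
  then show ?thesis using B(1) by blast
qed

subsection \<open>Short words with large diagrams\<close>

text \<open>A leaf of length 1/qI that starts left of \<open>c\<close> goes to one of length 1/qJ
  with slope qI/qJ. If A'/B' is A/B in lowest terms, coprimality forces A'^M to divide qI, so such
  leaves have length at most 1/2^M.\<close>

lemma leaves_ge_of_slope:
  fixes A B :: nat
  assumes "represents k n D R x" "0 < A" "0 < B" "\<not> A dvd B" "0 < c" "c \<le> 1"
    and lin: "\<And>t. t \<in> {0..c} \<Longrightarrow> x t = (real A / real B) ^ M * t"
  shows "c * 2 ^ M \<le> real (leaves D)"
proof -
  define A' B' where "A' = A div gcd A B" and "B' = B div gcd A B"
  have AB: "A = A' * gcd A B" "B = B' * gcd A B" by (simp_all add: A'_def B'_def)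
  have cop: "coprime A' B'" using assms(2) unfolding A'_def B'_def by (intro div_gcd_coprime) simp
  have "B' > 0" "A' > 0" using AB assms(2,3) by (auto intro: gr0I)
  \<comment> \<open>With A' = 1, \<open>A\<close> would equal the gcd and hence divide
    \<open>B\<close>.\<close>
  have "A' \<noteq> 1" using AB assms(4) by (metis dvd_triv_right mult_1)
  then have "A' \<ge> 2" using \<open>A' > 0\<close> by simp
  have q: "real A / real B = real A' / real B'"
  proof -
    have "real A / real B = (real A' * real (gcd A B)) / (real B' * real (gcd A B))"
      using AB by (metis of_nat_mult)
    then show ?thesis using assms(2) by simp
  qed
  note ch = represents_chain[OF assms(1)]
  have "snd I - fst I \<le> 1 / 2 ^ M" if I: "I \<in> set (leaf_intervals 0 1 D)" "fst I < c" for I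
  proof -
    obtain i where i: "i < length (leaf_intervals 0 1 D)" "I = leaf_intervals 0 1 D ! i"
      using I(1) by (auto simp: in_set_conv_nth)
    define J where "J = leaf_intervals 0 1 R ! i"
    have J: "aff x I J" "J \<in> set (leaf_intervals 0 1 R)"
      using ch(3) i by (auto simp: list_all2_conv_all_nth J_def)
    have ary: "ary_tree caret_types D" "ary_tree caret_types R" using assms(1) by (auto simp: represents_iff)
    obtain qI qJ :: nat where q': "qI > 0" "qJ > 0" "snd I - fst I = 1 / real qI" "snd J - fst J = 1 / real qJ"
      using standard_interval_leaf_intervals[OF ary(1) I(1)] standard_interval_leaf_intervals[OF ary(2) J(2)]
      unfolding standard_interval_def by blast
    define u where "u = fst I"
    \<comment> \<open>The leaf may reach beyond \<open>c\<close>; its part inside [0,c] already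
      determines the slope.\<close>
    define v where "v = min c (snd I)"
    have uv: "u < v" "u \<in> {fst I..snd I}" "v \<in> {fst I..snd I}" "u \<in> {0..c}" "v \<in> {0..c}"
      using I chain_nondeg[OF ch(1) I(1)] chain_bounds[OF ch(1) I(1)] by (auto simp: u_def v_def)
    have "(snd J - fst J) / (snd I - fst I) * (v - u) = (real A' / real B') ^ M * (v - u)"
      using aff_slope[OF J(1) uv(2,3)] lin[OF uv(4)] lin[OF uv(5)] q by (simp add: right_diff_distrib)
    then have "(snd J - fst J) / (snd I - fst I) = (real A' / real B') ^ M"
      using uv(1) unfolding mult_cancel_right by simp
    then have "real qI / real qJ = (real A' / real B') ^ M"
      unfolding q'(3,4) using q'(1,2) by simp
    then have "real qI * real B' ^ M = real qJ * real A' ^ M"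
      using q' \<open>B' > 0\<close> by (simp add: power_divide field_simps)
    then have "real (qI * B' ^ M) = real (qJ * A' ^ M)" by simp
    then have "qI * B' ^ M = qJ * A' ^ M" by (simp only: of_nat_eq_iff)
    then have "A' ^ M dvd qI * B' ^ M" by simp
    then have "A' ^ M dvd qI" using cop by (simp add: coprime_dvd_mult_left_iff)
    then have "A' ^ M \<le> qI" using q'(1) by (rule dvd_imp_le)
    moreover have "2 ^ M \<le> A' ^ M" using \<open>A' \<ge> 2\<close> by (rule power_mono) simp
    ultimately have "2 ^ M \<le> qI" by simp
    then have "(2::real) ^ M \<le> real qI" by (metis of_nat_le_iff of_nat_numeral of_nat_power)
    then show ?thesis unfolding q'(3) by (intro divide_left_mono) (use q' in auto)
  qed
  then have "c - 0 \<le> real (length (leaf_intervals 0 1 D)) * (1 / 2 ^ M)"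
    using assms by (intro chain_cover[OF ch(1)]) auto
  then show ?thesis by (simp add: length_leaf_intervals field_simps)
qed

section \<open>The generators near 0\<close>

lemma represents_hd:
  assumes "represents k n D R x" "hd (leaf_intervals 0 1 D) = (0, u)" "hd (leaf_intervals 0 1 R) = (0, v)"
    and "t \<in> {0..u}"
  shows "x t = t * v / u"
proof -
  note ch = represents_chain[OF assms(1)]
  obtain I K where K: "leaf_intervals 0 1 D = I # K" using ch(1) by (cases "leaf_intervals 0 1 D") auto
  then obtain J L where L: "leaf_intervals 0 1 R = J # L" "aff x I J"
    using ch(3) by (auto simp: list_all2_Cons1)
  then show ?thesis using assms K by (simp add: aff_def)
qed

lemma hd_leaf_intervals_right_string:
  assumes "d > 0"
  shows "hd (leaf_intervals 0 1 (right_string (n 1) d)) = (0, 1 / real (n 1))"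
proof -
  obtain e where e: "d = Suc e" using assms by (cases d) auto
  obtain p where p: "n 1 = Suc (Suc p)" using n1_ge_2 by (metis One_nat_def Suc_1 Suc_le_D le_SucE Suc_le_mono)
  show ?thesis
    unfolding e right_string.simps p
    using hd_leaf_intervals_Caret[of 0 1 "replicate p Leaf @ [right_string (Suc (Suc p)) e]" Leaf]
    by (simp del: leaf_intervals.simps(2))
qed

text \<open>More than one leaf forces a caret in the domain string, whose first leaf is then
  [0, 1/n_1]. The slope is the quotient of \<open>v\<close> by 1/n_1.\<close>

lemma string_elt_near_0:
  assumes "ary_tree caret_types R" "leaves R > 1" "hd (leaf_intervals 0 1 R) = (0, v)"
    and "t \<in> {0..1 / real (n 1)}"
  shows "string_elt k n R t = real (n 1) * v * t"
proof -
  obtain d where d: "represents k n (right_string (n 1) d) R (string_elt k n R)"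
    using string_elt(2)[OF assms(1)] by blast
  then have "leaves (right_string (n 1) d) = leaves R" by (simp add: represents_def)
  then have "d > 0" using assms(2) by (intro gr0I) simp
  then show ?thesis
    using represents_hd[OF d hd_leaf_intervals_right_string assms(3,4)] by (simp add: mult_ac)
qed

lemma leaves_Caret_replicate: "leaves (Caret (replicate m Leaf)) = m"
  by (simp add: sum_list_replicate)

lemma hd_leaf_intervals_Caret_replicate:
  assumes "m > 0"
  shows "hd (leaf_intervals a b (Caret (replicate m Leaf))) = (a, a + (b - a) / real m)"
proof -
  obtain p where "m = Suc p" using assms by (cases m) auto
  then show ?thesis
    using hd_leaf_intervals_Caret[of a b "replicate p Leaf" Leaf] by (simp del: leaf_intervals.simps(2))
qed

text \<open>For index 0 the string is a single leaf, so the range tree is one n_j-ary caret, whose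
  first leaf has length 1/n_j.\<close>

lemma y_gen_near_0:
  assumes "j \<in> {1..k}" "t \<in> {0..1 / real (n 1)}"
  shows "y_gen k n j 0 t = real (n 1) / real (n j) * t"
proof -
  have j: "n j \<ge> 2" "n j \<in> caret_types" using n_ge_2 assms(1) by auto
  have "y_gen k n j 0 = string_elt k n (Caret (replicate (n j) Leaf))" by (simp add: y_gen_def)
  then show ?thesis
    using string_elt_near_0[of "Caret (replicate (n j) Leaf)" "1 / real (n j)" t] assms(2) j
      hd_leaf_intervals_Caret_replicate[of "n j" 0 1] leaves_Caret_replicate
    by (simp del: leaf_intervals.simps(2) leaves.simps(2))
qed

text \<open>The range tree is an n_1-ary caret with a second one attached to its first leaf, so its
  leftmost leaf has length 1/n_1^2.\<close>

lemma z_gen_near_0: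
  assumes "t \<in> {0..1 / real (n 1)}"
  shows "z_gen k n 1 0 t = t / real (n 1)"
proof -
  obtain p where p: "n 1 = Suc (Suc p)" using n1_ge_2 by (metis One_nat_def Suc_1 Suc_le_D le_SucE Suc_le_mono)
  define T where "T = Caret (replicate (n 1) Leaf)"
  define R where "R = Caret (T # replicate p Leaf @ [Leaf])"
  have z: "z_gen k n 1 0 = string_elt k n R" 
    unfolding z_gen_def R_def T_def p by simp
  have R: "ary_tree caret_types R" using n1_arity p by (simp add: R_def T_def)
  have "leaves T > 1" using leaves_Caret_replicate[of "n 1"] n1_ge_2 by (simp add: T_def)
  then have lR: "leaves R > 1" by (simp add: R_def)
  have "leaf_intervals a b T \<noteq> []" for a b
    using \<open>leaves T > 1\<close> length_leaf_intervals[of a b T] by auto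
  then have "hd (leaf_intervals 0 1 R) = hd (leaf_intervals 0 (1 / real (n 1)) T)"
    unfolding R_def using p by (subst hd_leaf_intervals_Caret) simp_all
  also have "\<dots> = (0, 1 / real (n 1) / real (n 1))"
    unfolding T_def using n1_ge_2 by (subst hd_leaf_intervals_Caret_replicate) simp_all
  finally show ?thesis using string_elt_near_0[OF R lR _ assms] z n1_ge_2 by simp
qed

text \<open>
  With \<open>n\<^sub>1\<^sup>a < n\<^sub>j < n\<^sub>1\<^sup>a\<^sup>+\<^sup>1\<close>, the quotient of \<open>n\<^sub>j\<close> by \<open>n\<^sub>1\<^sup>a\<close> would lie strictly between
  \<open>1\<close> and \<open>n\<^sub>1\<close> but be congruent to \<open>1\<close> modulo \<open>n\<^sub>1 - 1\<close>.
\<close>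

lemma arity_between_powers:
  assumes "j \<in> {1..k}" "\<And>e. n j \<noteq> n 1 ^ e"
  shows "\<exists>a. n 1 ^ a < n j \<and> \<not> n 1 ^ a dvd n j"
proof -
  define p where "p = n 1 - 1"
  have n1: "n 1 = p + 1" using n1_ge_2 by (simp add: p_def)
  obtain a where a: "n 1 ^ a \<le> n j" "n j < n 1 ^ (a + 1)"
    using ex_power_ivl1[of "n 1" "n j"] n1_ge_2 n_ge_2[OF assms(1)] by auto
  have lt: "n 1 ^ a < n j" using a(1) assms(2)[of a] by simp
  have "\<exists>d. n 1 ^ a = 1 + p * d"
  proof (induction a)
    case 0
    then show ?case by (intro exI[of _ 0]) simp
  next
    case (Suc a)
    then obtain d where "n 1 ^ a = 1 + p * d" by blast
    then have "n 1 ^ Suc a = 1 + p * (d * (p + 1) + 1)"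
      unfolding power_Suc n1 by (simp add: algebra_simps)
    then show ?case by blast
  qed
  then obtain d where d: "n 1 ^ a = 1 + p * d" by blast
  have "\<not> n 1 ^ a dvd n j"
  proof
    assume "n 1 ^ a dvd n j"
    then obtain c where c: "n j = n 1 ^ a * c" by (elim dvdE)
    have "c > 1" using lt unfolding c by (cases c) auto
    moreover have "c < n 1" using a(2) unfolding c by simp
    \<comment> \<open>By \<open>n 1 ^ a = 1 + p * d\<close>, n_j - 1 is congruent to c - 1 modulo
      \<open>p\<close>.\<close>
    moreover have "n j - 1 = p * (d * c) + (c - 1)"
      using \<open>c > 1\<close> unfolding c d by (simp add: algebra_simps)
    then have "p dvd c - 1"
      using n1_dvd[OF assms(1)] unfolding p_def[symmetric] by (simp add: dvd_add_right_iff)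
    then have "p \<le> c - 1" using \<open>c > 1\<close> by (intro dvd_imp_le) auto
    ultimately show False unfolding n1 by simp
  qed
  then show ?thesis using lt by blast
qed

text \<open>First \<open>y\<close> acts with slope n_1/n_j, then \<open>b = a - 1\<close> copies of
  the inverse of \<open>z\<close> act with slope n_1 each, in total n_1^a/n_j. It has to be checked
  that intermediate values stay where these formulas hold.\<close>

lemma contracting_word:
  assumes "j \<in> {1..k}" "\<And>e. n j \<noteq> n 1 ^ e"
  shows "\<exists>ws A B. set ws \<subseteq> signed_gens \<and> 0 < A \<and> A < B \<and> \<not> A dvd (B::nat) \<and>
    (\<forall>t\<in>{0..1 / real (n 1)}. foldr (\<lambda>g. g) ws t = real A / real B * t)"
proof -
  define y where "y = y_gen k n j 0"
  define z where "z = z_gen k n 1 0"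
  define z' where "z' = inv\<^bsub>TS k n\<^esub> z"
  have "j \<noteq> 1" using assms(2)[of 1] by auto
  then have j: "j \<in> {2..k}" using assms(1) by auto
  have pos: "n 1 > 0" "n j > 0" using n1_ge_2 n_ge_2[OF assms(1)] by auto
  have "y \<in> std_gens k n" using j pos unfolding std_gens_def y_def by blast
  moreover have "z \<in> std_gens k n" using k_gt_1 pos unfolding std_gens_def z_def by force
  ultimately have gens: "y \<in> signed_gens" "z' \<in> signed_gens"
    by (auto simp: signed_gens_def z'_def)
  \<comment> \<open>\<open>z\<close> contracts [0, 1/n_1] onto [0, 1/n_1^2], so its inverse expands
    the latter interval.\<close>
  have Z': "z' t = real (n 1) * t" if "t \<in> {0..1 / real (n 1) ^ 2}" for t
  proof -
    have s: "real (n 1) * t \<in> {0..1 / real (n 1)}"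
      using that pos by (auto simp: field_simps power2_eq_square)
    moreover have "1 / real (n 1) \<le> 1" using pos by simp
    ultimately have "real (n 1) * t \<in> {0..1}" by auto
    moreover have "z \<in> diagram_elts" unfolding z_def using k_gt_1 by (intro z_gen_diagram_elts) simp
    ultimately have "z' (z (real (n 1) * t)) = real (n 1) * t"
      unfolding z'_def by (intro diagram_elts_inv(2))
    moreover have "z (real (n 1) * t) = t"
      using z_gen_near_0[OF s] pos by (simp add: z_def)
    ultimately show ?thesis by simp
  qed
  have Z'_iter: "foldr (\<lambda>g. g) (replicate b z') t = real (n 1) ^ b * t"
    if "t \<in> {0..1 / real (n 1) ^ (b + 1)}" for b t
    using that
  proof (induction b)
    case (Suc b)
    have "1 / real (n 1) ^ (Suc b + 1) \<le> 1 / real (n 1) ^ (b + 1)"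
      using pos by (intro divide_left_mono power_increasing) auto
    then have IH: "foldr (\<lambda>g. g) (replicate b z') t = real (n 1) ^ b * t"
      using Suc by auto
    have "real (n 1) ^ b * t \<le> real (n 1) ^ b * (1 / real (n 1) ^ (Suc b + 1))"
      using Suc.prems by (intro mult_left_mono) auto
    also have "\<dots> = 1 / real (n 1) ^ 2" using pos by (simp add: power2_eq_square)
    finally have "z' (real (n 1) ^ b * t) = real (n 1) * (real (n 1) ^ b * t)"
      using Suc.prems by (intro Z') auto
    then show ?case using IH by simp
  qed simp
  obtain a where a: "n 1 ^ a < n j" "\<not> n 1 ^ a dvd n j"
    using arity_between_powers[OF assms] by blast
  \<comment> \<open>\<open>a\<close> is positive because \<open>n 1 ^ 0 = 1\<close> divides
    \<open>n j\<close>.\<close>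
  then obtain b where b: "a = b + 1" by (cases a) auto
  have "foldr (\<lambda>g. g) (replicate b z' @ [y]) t = real (n 1 ^ a) / real (n j) * t"
    if t: "t \<in> {0..1 / real (n 1)}" for t
  proof -
    have y: "y t = real (n 1) / real (n j) * t" using y_gen_near_0[OF assms(1) t] by (simp add: y_def)
    have "y t \<le> real (n 1) / real (n j) * (1 / real (n 1))"
      unfolding y using t by (intro mult_left_mono) auto
    also have "\<dots> = 1 / real (n j)" using pos by simp
    \<comment> \<open>The bound n_1^a < n_j places \<open>y t\<close> in the interval on which
      \<open>Z'_iter\<close> applies.\<close>
    also have "\<dots> \<le> 1 / real (n 1 ^ (b + 1))"
      using a(1) pos unfolding b by (intro divide_left_mono of_nat_mono) auto
    finally have "y t \<in> {0..1 / real (n 1) ^ (b + 1)}" using t y by simp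
    then show ?thesis using Z'_iter[of "y t" b] y b by simp
  qed
  moreover have "set (replicate b z' @ [y]) \<subseteq> signed_gens" using gens by auto
  moreover have "0 < n 1 ^ a" using pos by simp
  ultimately show ?thesis using a by blast
qed

text \<open>Since 0 \<le> s \<le> 1, the iterates never leave [0,c], so the linear formula can be
  used again.\<close>

lemma foldr_concat_replicate:
  assumes "\<And>t. t \<in> {0..c} \<Longrightarrow> foldr (\<lambda>g. g) ws t = s * t" "0 \<le> s" "s \<le> 1" "t \<in> {0..c}"
  shows "foldr (\<lambda>g. g) (concat (replicate M ws)) t = s ^ M * (t :: real)"
proof (induction M)
  case (Suc M)
  have "s ^ M * t \<le> 1 * t" using assms by (intro mult_right_mono power_le_one) auto
  then have "s ^ M * t \<in> {0..c}" using assms by auto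
  then show ?case using assms(1) Suc by (simp add: mult.assoc)
qed simp

lemma min_leaves_ge:
  assumes "x \<in> diagram_elts" "\<And>D R. represents k n D R x \<Longrightarrow> l \<le> leaves D"
  shows "l \<le> min_leaves k n x"
proof -
  have "\<exists>m D R. represents k n D R x \<and> leaves D = m"
    using assms(1) by (auto simp: diagram_elts_def)
  then have "\<exists>D R. represents k n D R x \<and> leaves D = min_leaves k n x"
    unfolding min_leaves_def by (rule LeastI_ex)
  then show ?thesis using assms(2) by metis
qed

lemma logarithmic_word_length:
  assumes "j \<in> {1..k}" "\<And>e. n j \<noteq> n 1 ^ e"
  shows "\<exists>C::real. C > 0 \<and> (\<exists>x :: nat \<Rightarrow> real \<Rightarrow> real.
               (\<forall>m. x m \<in> carrier (TS k n)) \<and>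
               filterlim (\<lambda>m. min_leaves k n (x m)) at_top sequentially \<and>
               (\<forall>m\<ge>1. ereal_of_enat (word_length (TS k n) (std_gens k n) (x m))
                        \<le> ereal (C * ln (real (min_leaves k n (x m))))))"
proof -
  obtain ws A B where ws: "set ws \<subseteq> signed_gens" "0 < A" "A < B" "\<not> A dvd (B::nat)"
    "\<And>t. t \<in> {0..1 / real (n 1)} \<Longrightarrow> foldr (\<lambda>g. g) ws t = real A / real B * t"
    using contracting_word[OF assms] by blast
  \<comment> \<open>The length 1/n_1 of the linear region costs a factor n_1 in
    \<open>leaves_ge_of_slope\<close>. As n_1 \<le> 2^K, \<open>K\<close> extra repetitions of
    \<open>ws\<close> make up for it and leave the clean bound 2^m.\<close>
  define K where "K = n 1"
  define v where "v m = concat (replicate (m + K) ws)" for m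
  define x where "x m = word_product (v m)" for m
  \<comment> \<open>For m \<ge> 1 the length (m + K) |ws| is at most m (1 + K) (1 + |ws|), and m ln
    2 is at most the logarithm of the leaf count.\<close>
  define C where "C = (1 + real K) * (1 + real (length ws)) / ln 2"
  have v: "set (v m) \<subseteq> signed_gens" for m using ws(1) by (auto simp: v_def)
  then have v': "set (v m) \<subseteq> diagram_elts" for m using signed_gens_diagram_elts by blast
  have xd: "x m \<in> diagram_elts" for m unfolding x_def by (rule word_product_diagram_elts(1)[OF v'])
  have unit: "0 < 1 / real (n 1)" "1 / real (n 1) \<le> 1" using n1_ge_2 by auto
  have lin: "x m t = (real A / real B) ^ (m + K) * t" if t: "t \<in> {0..1 / real (n 1)}" for m t
  proof -
    have "t \<in> {0..1}" using t unit(2) by (meson atLeastAtMost_iff order_trans)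
    then have "x m t = foldr (\<lambda>g. g) (v m) t"
      unfolding x_def by (rule word_product_diagram_elts(2)[OF v'])
    also have "\<dots> = (real A / real B) ^ (m + K) * t"
      unfolding v_def using ws(2,3) by (intro foldr_concat_replicate[OF ws(5) _ _ t]) auto
    finally show ?thesis .
  qed
  have ge: "2 ^ m \<le> min_leaves k n (x m)" for m
  proof (rule min_leaves_ge[OF xd])
    fix D R assume DR: "represents k n D R (x m)"
    have "1 / real (n 1) * 2 ^ (m + K) \<le> real (leaves D)"
      using ws(2-4) unit lin by (intro leaves_ge_of_slope[OF DR, of A B]) auto
    moreover have "real (n 1) \<le> 2 ^ K"
      unfolding K_def using less_exp[of "n 1"] by (metis less_imp_le of_nat_le_iff of_nat_numeral of_nat_power)
    then have "2 ^ m \<le> 1 / real (n 1) * (2::real) ^ (m + K)"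
      using unit by (simp add: power_add field_simps)
    ultimately have "(2::real) ^ m \<le> real (leaves D)" by linarith
    then have "real (2 ^ m) \<le> real (leaves D)" by (simp only: of_nat_power of_nat_numeral)
    then show "2 ^ m \<le> leaves D" by (simp only: of_nat_le_iff)
  qed
  have "filterlim (\<lambda>m. min_leaves k n (x m)) at_top sequentially"
  proof (rule filterlim_at_top_mono[OF filterlim_ident])
    show "\<forall>\<^sub>F m in sequentially. m \<le> min_leaves k n (x m)"
      using ge less_exp by (intro always_eventually allI) (meson le_trans less_imp_le)
  qed
  moreover have "ereal_of_enat (word_length (TS k n) (std_gens k n) (x m))
      \<le> ereal (C * ln (real (min_leaves k n (x m))))" if "m \<ge> 1" for m
  proof -
    have len: "length (v m) = (m + K) * length ws" by (simp add: v_def length_concat sum_list_replicate)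
    have "word_length (TS k n) (std_gens k n) (x m) \<le> enat ((m + K) * length ws)"
      using word_length_le[OF v[of m]] unfolding x_def len .
    then have "ereal_of_enat (word_length (TS k n) (std_gens k n) (x m))
        \<le> ereal_of_enat (enat ((m + K) * length ws))"
      by (simp only: ereal_of_enat_le_iff)
    also have "\<dots> = ereal (real ((m + K) * length ws))" by simp
    also have "\<dots> \<le> ereal (C * ln (real (min_leaves k n (x m))))"
    proof -
      have "m + K \<le> m * (1 + K)" using that by (cases m) auto
      then have "(m + K) * length ws \<le> m * (1 + K) * (1 + length ws)" by (intro mult_mono) auto
      then have "real ((m + K) * length ws) \<le> real (m * (1 + K) * (1 + length ws))"
        by (simp only: of_nat_le_iff)
      also have "\<dots> = C * (real m * ln 2)" by (simp add: C_def field_simps)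
      also have "real m * ln 2 = ln (2 ^ m)" by (simp add: ln_realpow)
      also have "C * ln (2 ^ m) \<le> C * ln (real (min_leaves k n (x m)))"
      proof (intro mult_left_mono)
        have "(2::real) ^ m \<le> real (min_leaves k n (x m))"
          using ge[of m] by (metis of_nat_le_iff of_nat_numeral of_nat_power)
        then show "ln (2 ^ m) \<le> ln (real (min_leaves k n (x m)))" by (intro ln_mono) auto
        show "0 \<le> C" by (simp add: C_def)
      qed
      finally show ?thesis by simp
    qed
    finally show ?thesis .
  qed
  moreover have "C > 0" unfolding C_def by (intro divide_pos_pos mult_pos_pos) auto
  moreover have "x m \<in> carrier (TS k n)" for m using xd diagram_elts_carrier by blast
  ultimately show ?thesis by blast
qed

end

text \<open>\<open>nondegenerate\<close> supplies the arity for the contracting word. In the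
  excluded case every slope is a power of n_1, and a contraction by such a slope has reduced
  numerator 1, so the denominator argument gives no growth.\<close>

theorem mainTheorem9:
  fixes k :: nat and n :: "nat \<Rightarrow> nat"
  assumes "k > 1"
    and "\<And>j. j \<in> {1..k} \<Longrightarrow> n j \<ge> 2"
    and "\<And>j. j \<in> {1..k} \<Longrightarrow> n 1 - 1 dvd n j - 1"
    and nondegenerate: "\<exists>j\<in>{1..k}. \<forall>e::nat. n j \<noteq> n 1 ^ e"
  shows "(\<exists>B::nat. B > 1 \<and>
            (\<forall>x \<in> carrier (TS k n).
               ereal (log (real B) (real (min_leaves k n x)))
                 \<le> ereal_of_enat (word_length (TS k n) (std_gens k n) x))) \<and>
         (\<exists>C::real. C > 0 \<and>
            (\<exists>x :: nat \<Rightarrow> real \<Rightarrow> real.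
               (\<forall>m\<ge>1. x m \<in> carrier (TS k n)) \<and>
               filterlim (\<lambda>m. min_leaves k n (x m)) at_top sequentially \<and>
               (\<forall>m\<ge>1. ereal_of_enat (word_length (TS k n) (std_gens k n) (x m))
                        \<le> ereal (C * ln (real (min_leaves k n (x m)))))))"
proof -
  interpret stein_params k n using assms by unfold_locales
  obtain j where j: "j \<in> {1..k}" "\<And>e. n j \<noteq> n 1 ^ e" using nondegenerate by blast
  show ?thesis using word_length_ge_log_min_leaves logarithmic_word_length[OF j] by blast
qed

end
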